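(* For a fixed precision $\epsilon>0$, the time complexity and the memory complexity of the block-partitioned butterfly algorithm described in the context (including both the factorization/precomputation phase and the application phase) for applying an odd or even associated Legendre transform (ALT) matrix of size $N\times N$ to a vector are $$ \mathcal{O}\left((r(N))^2\, N \log^2(N)\right), $$ where $r(N)$ is the least upper bound for both the ranks (to precision $\epsilon$) of the non-oscillatory blocks which do not intersect the turning point curve and the ranks (to precision $\epsilon$) of the subblocks of the oscillatory portion of the matrix.
   Context: **ALT matrices.** Let $\overline{P}_k^{m}$ denote the $L^2$-normalized associated Legendre function of degree $k$ and order $m$. Let $N\ge 1$ and let $m$ be an integer with $|m|\le 2N-1$. Consider the $2N$-point Gauss-Legendre quadrature rule on $(-1,1)$, whose nodes are symmetric about $0$, and let $\theta_i\in(0,\pi/2)$, $i=1,\dots,N$ (listed in monotone order), be such that the $\cos(\theta_i)$ are its $N$ positive nodes. The odd (resp. even) ALT matrix of order $m$ has rows indexed by $i=1,\dots,N$, columns indexed by those $k$ with $|m|\le k\le 2N-1$ and $k-|m|$ odd (resp. even) in increasing order, and entries $\overline{P}_k^{|m|}(\cos(\theta_i))$. The odd matrix is $N\times(N-\lceil |m|/2\rceil)$ and the even matrix is $N\times (N-\lfloor |m|/2\rfloor)$ (matrices with no columns are disregarded). In the claim, "of size $N\times N$" refers to these matrices with $N$ as the size parameter. Each entry can be evaluated in $\mathcal{O}(1)$ operations, independently of $k$ and $m$. **Turning point curve.** For $|m|>0$ let $t^*_{k,m}=\arcsin\left(\sqrt{m^2-1/4}/(k+1/2)\right)$. An entry (row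 $i$, column $k$) lies in the non-oscillatory region if $\theta_i<t^*_{k,m}$ and in the oscillatory region if $\theta_i>t^*_{k,m}$; for $m=0$ all entries are oscillatory. The curve $k\mapsto t^*_{k,m}$ separating the two regions is the turning point curve. A block (contiguous rows and columns) intersects the curve if it is not contained in a single one of the two regions. **Numerical rank.** The rank of a matrix $A\in\mathbb{C}^{p\times q}$ to precision $\epsilon$ is $\min\{\operatorname{rank}(X): X\in\mathbb{C}^{p\times q},\ \|A-X\|_2\le\epsilon\}$. **Complementary low-rank structure and the IDBF.** For an $N_0\times N_0$ matrix $K$ with row set $X$ and column set $\Omega$, let $T_X,T_\Omega$ be the trees obtained by recursive bisection of $X,\Omega$, both of depth $L_0=\mathcal{O}(\log N_0)$, with leaves containing $\mathcal{O}(1)$ indices and the root at level $0$. The relevant subblocks of $K$ are the submatrices $K(A,B)$ with $A\in T_X$ at level $\ell$ and $B\in T_\Omega$ at level $L_0-\ell$, $0\le\ell\le L_0$; $K$ is complementary low-rank if all of these are numerically low-rank. The interpolative decomposition butterfly factorization (IDBF) approximates $K\approx U^{L_0}U^{L_0-1}\cdots U^{h}S^hV^h\cdots V^{L_0-1}V^{L_0}$, $h=L_0/2$, with sparse factors, using interpolative decompositions of these subblocks. If the ranks of these subblocks are bounded by $r$ and entries of $K$ can be evaluated in $\mathcal{O}(1)$ operations, then constructing the IDBF takes $\mathcal{O}(r^2N_0\log N_0)$ operations and memory, and applying it to a vector takes $\mathcal{O}(r^2N_0\log N_0)$ operations and memory. **Randomized low-rank factorization.** For an $N_0\times N_0$ matrix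 of numerical rank at most $r$ with entries available in $\mathcal{O}(1)$ operations, an approximate factorization $U\Sigma V^T$ of rank $r$ is built by randomized row/column sampling in $\mathcal{O}(r^2N_0)$ operations and $\mathcal{O}(rN_0)$ memory, and applied to a vector in $\mathcal{O}(rN_0)$ operations and memory. **The algorithm.** Fix a parameter $n_0$ (independent of $N$). 1. *Partitioning.* Split the rows of the odd (resp. even) ALT matrix into $b$ contiguous groups to obtain $b$ nearly square blocks each containing all columns, where $b$ is the nearest integer to $N/(N-\lceil|m|/2\rceil)$ (resp. $N/(N-\lfloor|m|/2\rfloor)$). Then repeatedly split each block that intersects the turning point curve into a $2\times2$ grid of subblocks, stopping once every block that intersects the curve has fewer than $n_0$ rows or fewer than $n_0$ columns. There are at most $\log(N/n_0)$ levels (up to a constant); at level $\ell$ blocks have size $\mathcal{O}(N/2^\ell)\times\mathcal{O}(N/2^\ell)$ and there are $\mathcal{O}(2^\ell)$ of them. 2. *Factorization and application.* - Each final block contained in the oscillatory region is factorized and applied by the IDBF. - For each final block contained in the non-oscillatory region, take the largest subblock containing no element of magnitude below machine precision, neglect the remainder, and factorize and apply that subblock by the randomized low-rank factorization. - Each final block intersecting the turning point curve is reduced to a smaller submatrix which excludes as many entries of magnitude below machine precision as possible, and is applied by standard matrix-vector multiplication. The product of the ALT matrix with a vector is obtained by adding the contributions of all blocks. **The quantity $r(N)$.** It is the least upper bound of the ranks to precision $\epsilon$ of all final non-oscillatory blocks not intersecting the turning point curve, and of all the relevant subblocks (in the sense of the complementary low-rank structure above) of the final oscillatory blocks. *)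

theory Defs
  imports "HOL-Analysis.Analysis" "Jordan_Normal_Form.DL_Rank_Submatrix"
begin

subsection \<open>Associated Legendre functions and Gauss-Legendre angles\<close>

text \<open>Rodrigues' formula.\<close>
definition legendre_poly :: "nat \<Rightarrow> real poly" where
  "legendre_poly k = Polynomial.smult (1 / (2 ^ k * fact k)) ((pderiv ^^ k) ([:-1, 0, 1:] ^ k))"

definition assoc_legendre :: "nat \<Rightarrow> nat \<Rightarrow> real \<Rightarrow> real" where
  "assoc_legendre k m x = (-1) ^ m * sqrt (1 - x\<^sup>2) ^ m * poly ((pderiv ^^ m) (legendre_poly k)) x"

definition norm_assoc_legendre :: "nat \<Rightarrow> nat \<Rightarrow> real \<Rightarrow> real" where
  "norm_assoc_legendre k m x =
     assoc_legendre k m x / sqrt (integral {-1..1} (\<lambda>t. (assoc_legendre k m t)\<^sup>2))"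

definition gauss_legendre_rule :: "nat \<Rightarrow> real set \<Rightarrow> (real \<Rightarrow> real) \<Rightarrow> bool" where
  "gauss_legendre_rule n X w \<longleftrightarrow>
     X \<subseteq> {-1<..<1} \<and> finite X \<and> card X = n \<and>
     (\<forall>p :: real poly. degree p < 2 * n \<longrightarrow> (\<Sum>x\<in>X. w x * poly p x) = integral {-1..1} (poly p))"

text \<open>Rows are indexed from \<open>0\<close>: \<open>th i\<close> for \<open>i < N\<close>. The monotone order may be increasing or
  decreasing.\<close>
definition gauss_legendre_angles :: "nat \<Rightarrow> (nat \<Rightarrow> real) \<Rightarrow> bool" where
  "gauss_legendre_angles N th \<longleftrightarrow>
     (\<exists>X w. gauss_legendre_rule (2 * N) X w \<and>
            (\<lambda>i. cos (th i)) ` {..<N} = {x \<in> X. 0 < x}) \<and>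
     th ` {..<N} \<subseteq> {0<..<pi / 2} \<and>
     (monotone_on {..<N} (<) (<) th \<or> monotone_on {..<N} (<) (>) th)"

subsection \<open>ALT matrices and the turning point curve\<close>

text \<open>The flag \<open>od\<close> selects the odd (\<open>True\<close>) or the even (\<open>False\<close>) matrix. The list contains the
  degrees \<open>k\<close> of the columns, so that column \<open>j\<close> has degree \<open>degrees N m od ! j\<close>.\<close>
definition degrees :: "nat \<Rightarrow> int \<Rightarrow> bool \<Rightarrow> nat list" where
  "degrees N m od = filter (\<lambda>k. odd (k - nat \<bar>m\<bar>) = od) [nat \<bar>m\<bar> ..< 2 * N]"

definition num_cols :: "nat \<Rightarrow> int \<Rightarrow> bool \<Rightarrow> nat" where
  "num_cols N m od = length (degrees N m od)"

text \<open>Matrices without columns are disregarded.\<close>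
definition admissible :: "nat \<Rightarrow> int \<Rightarrow> bool \<Rightarrow> bool" where
  "admissible N m od \<longleftrightarrow> 1 \<le> N \<and> \<bar>m\<bar> \<le> 2 * int N - 1 \<and> 0 < num_cols N m od"

text \<open>The entries are real; they are embedded into the complex numbers because the numerical rank
  is defined by complex approximants.\<close>
definition alt_mat :: "(nat \<Rightarrow> real) \<Rightarrow> nat \<Rightarrow> int \<Rightarrow> bool \<Rightarrow> complex mat" where
  "alt_mat th N m od = mat N (num_cols N m od)
     (\<lambda>(i, j). complex_of_real (norm_assoc_legendre (degrees N m od ! j) (nat \<bar>m\<bar>) (cos (th i))))"

definition turning_point :: "nat \<Rightarrow> int \<Rightarrow> real" where
  "turning_point k m = arcsin (sqrt ((of_int m)\<^sup>2 - 1 / 4) / (real k + 1 / 2))"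

text \<open>Entries with \<open>th i\<close> equal to the turning point belong to neither region.\<close>
definition osc_entry :: "(nat \<Rightarrow> real) \<Rightarrow> nat \<Rightarrow> int \<Rightarrow> bool \<Rightarrow> nat \<Rightarrow> nat \<Rightarrow> bool" where
  "osc_entry th N m od i j \<longleftrightarrow> m = 0 \<or> turning_point (degrees N m od ! j) m < th i"

definition nonosc_entry :: "(nat \<Rightarrow> real) \<Rightarrow> nat \<Rightarrow> int \<Rightarrow> bool \<Rightarrow> nat \<Rightarrow> nat \<Rightarrow> bool" where
  "nonosc_entry th N m od i j \<longleftrightarrow> m \<noteq> 0 \<and> th i < turning_point (degrees N m od ! j) m"

subsection \<open>Blocks\<close>

text \<open>A pair \<open>(a, b)\<close> stands for the index range \<open>{a..<b}\<close>; a block is a pair of a row range and a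
  column range.\<close>
type_synonym range = "nat \<times> nat"
type_synonym block = "range \<times> range"

definition indices :: "range \<Rightarrow> nat set" where
  "indices R = {fst R ..< snd R}"

definition height :: "block \<Rightarrow> nat" where "height B = card (indices (fst B))"
definition width :: "block \<Rightarrow> nat" where "width B = card (indices (snd B))"

definition block_mat :: "complex mat \<Rightarrow> block \<Rightarrow> complex mat" where
  "block_mat K B = submatrix K (indices (fst B)) (indices (snd B))"

definition halves :: "range \<Rightarrow> range set" where
  "halves R = (case R of (a, b) \<Rightarrow> {(a, a + (b - a) div 2), (a + (b - a) div 2, b)})"

primrec tree_level :: "range \<Rightarrow> nat \<Rightarrow> range set" where
  "tree_level R 0 = {R}"
| "tree_level R (Suc l) = (\<Union>R'\<in>tree_level R l. halves R')"

definition osc_block :: "(nat \<Rightarrow> real) \<Rightarrow> nat \<Rightarrow> int \<Rightarrow> bool \<Rightarrow> block \<Rightarrow> bool" where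
  "osc_block th N m od B \<longleftrightarrow>
     (\<forall>i\<in>indices (fst B). \<forall>j\<in>indices (snd B). osc_entry th N m od i j)"

definition nonosc_block :: "(nat \<Rightarrow> real) \<Rightarrow> nat \<Rightarrow> int \<Rightarrow> bool \<Rightarrow> block \<Rightarrow> bool" where
  "nonosc_block th N m od B \<longleftrightarrow>
     (\<forall>i\<in>indices (fst B). \<forall>j\<in>indices (snd B). nonosc_entry th N m od i j)"

definition crosses :: "(nat \<Rightarrow> real) \<Rightarrow> nat \<Rightarrow> int \<Rightarrow> bool \<Rightarrow> block \<Rightarrow> bool" where
  "crosses th N m od B \<longleftrightarrow> \<not> osc_block th N m od B \<and> \<not> nonosc_block th N m od B"

subsection \<open>Numerical rank\<close>

definition vec_norm2 :: "complex vec \<Rightarrow> real" where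
  "vec_norm2 v = L2_set (\<lambda>i. cmod (vec_index v i)) {..<dim_vec v}"

definition spectral_norm :: "complex mat \<Rightarrow> real" where
  "spectral_norm A = Sup {vec_norm2 (A *\<^sub>v v) | v. v \<in> carrier_vec (dim_col A) \<and> vec_norm2 v \<le> 1}"

definition numerical_rank :: "real \<Rightarrow> complex mat \<Rightarrow> nat" where
  "numerical_rank \<epsilon> A = (LEAST k. \<exists>X \<in> carrier_mat (dim_row A) (dim_col A).
     vec_space.rank (dim_row A) X = k \<and> spectral_norm (A - X) \<le> \<epsilon>)"

subsection \<open>Costs of the two factorizations\<close>

text \<open>Numbers of operations and memory cells used by a factorization method run at the fixed
  precision. The first argument of \<open>build_time\<close> bounds the cost of evaluating an entry.\<close>
record method_costs =
  build_time :: "nat \<Rightarrow> complex mat \<Rightarrow> nat"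
  build_mem :: "complex mat \<Rightarrow> nat"
  apply_time :: "complex mat \<Rightarrow> nat"
  apply_mem :: "complex mat \<Rightarrow> nat"

definition mat_size :: "complex mat \<Rightarrow> nat" where
  "mat_size K = max (dim_row K) (dim_col K)"

text \<open>\<open>L n\<close> is the common depth of the two trees for size parameter \<open>n\<close>; it is even because the
  middle level \<open>L n / 2\<close> is used by the butterfly factorization.\<close>
definition tree_depth :: "(nat \<Rightarrow> nat) \<Rightarrow> bool" where
  "tree_depth L \<longleftrightarrow>
     (\<forall>n. even (L n)) \<and>
     (\<exists>C. \<forall>n\<ge>2. real (L n) \<le> C * ln (real n)) \<and>
     (\<exists>c. \<forall>n. n \<le> c * 2 ^ L n)"

definition relevant_subblocks :: "(nat \<Rightarrow> nat) \<Rightarrow> complex mat \<Rightarrow> complex mat set" where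
  "relevant_subblocks L K =
     {block_mat K (A, B) | A B l. l \<le> L (mat_size K) \<and>
        A \<in> tree_level (0, dim_row K) l \<and>
        B \<in> tree_level (0, dim_col K) (L (mat_size K) - l)}"

text \<open>The blocks of the partition are only nearly square, so the cost bound for \<open>N\<^sub>0 \<times> N\<^sub>0\<close>
  matrices is stated for bounded aspect ratio with \<open>N\<^sub>0\<close> the larger dimension. A rank bound \<open>r\<close> is
  positive, and \<open>1 +\<close> keeps the bound positive for \<open>1 \<times> 1\<close> matrices.\<close>
definition idbf_complexity :: "real \<Rightarrow> (nat \<Rightarrow> nat) \<Rightarrow> method_costs \<Rightarrow> bool" where
  "idbf_complexity \<epsilon> L W \<longleftrightarrow>
     (\<forall>c \<kappa>. \<exists>C :: real. \<forall>K r.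
        0 < dim_row K \<and> 0 < dim_col K \<and> dim_row K \<le> \<kappa> * dim_col K \<and> dim_col K \<le> \<kappa> * dim_row K \<and>
        1 \<le> r \<and> (\<forall>S\<in>relevant_subblocks L K. numerical_rank \<epsilon> S \<le> r) \<longrightarrow>
        (\<forall>t\<in>{build_time W c K, build_mem W K, apply_time W K, apply_mem W K}.
           real t \<le> C * (real r)\<^sup>2 * real (mat_size K) * (1 + ln (real (mat_size K)))))"

definition lowrank_complexity :: "real \<Rightarrow> method_costs \<Rightarrow> bool" where
  "lowrank_complexity \<epsilon> W \<longleftrightarrow>
     (\<forall>c. \<exists>C :: real. \<forall>K r.
        0 < dim_row K \<and> 0 < dim_col K \<and> 1 \<le> r \<and> numerical_rank \<epsilon> K \<le> r \<longrightarrow>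
        real (build_time W c K) \<le> C * (real r)\<^sup>2 * real (mat_size K) \<and>
        (\<forall>t\<in>{build_mem W K, apply_time W K, apply_mem W K}.
           real t \<le> C * real r * real (mat_size K)))"

subsection \<open>Reduction of blocks by negligible entries\<close>

definition subblock_of :: "complex mat \<Rightarrow> block \<Rightarrow> bool" where
  "subblock_of K B \<longleftrightarrow> indices (fst B) \<subseteq> {..<dim_row K} \<and> indices (snd B) \<subseteq> {..<dim_col K}"

definition cells :: "block \<Rightarrow> (nat \<times> nat) set" where
  "cells B = indices (fst B) \<times> indices (snd B)"

text \<open>Positions of the entries below machine precision \<open>\<mu>\<close>.\<close>
definition tiny :: "real \<Rightarrow> complex mat \<Rightarrow> (nat \<times> nat) set" where
  "tiny \<mu> K = {(i, j). i < dim_row K \<and> j < dim_col K \<and> cmod (K $$ (i, j)) < \<mu>}"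

text \<open>The largest subblock may be empty and need not be unique.\<close>
definition largest_nontiny :: "real \<Rightarrow> complex mat \<Rightarrow> block \<Rightarrow> bool" where
  "largest_nontiny \<mu> K B \<longleftrightarrow>
     subblock_of K B \<and> cells B \<inter> tiny \<mu> K = {} \<and>
     (\<forall>B'. subblock_of K B' \<and> cells B' \<inter> tiny \<mu> K = {} \<longrightarrow> card (cells B') \<le> card (cells B))"

text \<open>No entry of magnitude at least \<open>\<mu>\<close> is dropped, and the number of dropped tiny entries is
  maximal.\<close>
definition best_reduction :: "real \<Rightarrow> complex mat \<Rightarrow> block \<Rightarrow> bool" where
  "best_reduction \<mu> K B \<longleftrightarrow>
     (let ok = (\<lambda>B. subblock_of K B \<and> {..<dim_row K} \<times> {..<dim_col K} - tiny \<mu> K \<subseteq> cells B)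
      in ok B \<and> (\<forall>B'. ok B' \<longrightarrow> card (tiny \<mu> K - cells B') \<le> card (tiny \<mu> K - cells B)))"

subsection \<open>The block-partitioned butterfly algorithm\<close>

text \<open>\<open>bookkeeping N m od B\<close> is charged, in operations and in memory, for every block examined during
  the partitioning (location relative to the curve, search of the reduced blocks). The functions
  \<open>trim\<close> and \<open>reduce\<close> choose the subblocks which are kept of a non-oscillatory block and of a block
  on the curve, in indices relative to that block.\<close>
record algorithm =
  min_size :: nat
  depth :: "nat \<Rightarrow> nat"
  entry_cost :: nat
  idbf :: method_costs
  lowrank :: method_costs
  bookkeeping :: "nat \<Rightarrow> int \<Rightarrow> bool \<Rightarrow> block \<Rightarrow> nat"
  trim :: "complex mat \<Rightarrow> block"
  reduce :: "complex mat \<Rightarrow> block"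

text \<open>For \<open>min_size \<le> 1\<close> a nonempty block on the curve never meets the stopping criterion.\<close>
definition valid_algorithm :: "real \<Rightarrow> real \<Rightarrow> algorithm \<Rightarrow> bool" where
  "valid_algorithm \<epsilon> \<mu> P \<longleftrightarrow>
     2 \<le> min_size P \<and>
     tree_depth (depth P) \<and>
     idbf_complexity \<epsilon> (depth P) (idbf P) \<and>
     lowrank_complexity \<epsilon> (lowrank P) \<and>
     (\<exists>C. \<forall>N m od B. bookkeeping P N m od B \<le> C * (height B + width B)) \<and>
     (\<forall>K. largest_nontiny \<mu> K (trim P K)) \<and>
     (\<forall>K. best_reduction \<mu> K (reduce P K))"

definition num_groups :: "nat \<Rightarrow> int \<Rightarrow> bool \<Rightarrow> nat" where
  "num_groups N m od = nat (round (real N / real (num_cols N m od)))"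

definition initial_blocks :: "nat \<Rightarrow> int \<Rightarrow> bool \<Rightarrow> block set" where
  "initial_blocks N m od =
     (let b = num_groups N m od
      in {((g * N div b, (g + 1) * N div b), (0, num_cols N m od)) | g. g < b})"

text \<open>Splitting a range of length one gives an empty range, which is discarded.\<close>
definition quarters :: "block \<Rightarrow> block set" where
  "quarters B = {B' \<in> halves (fst B) \<times> halves (snd B). cells B' \<noteq> {}}"

primrec blocks_at :: "(nat \<Rightarrow> real) \<Rightarrow> nat \<Rightarrow> int \<Rightarrow> bool \<Rightarrow> nat \<Rightarrow> block set" where
  "blocks_at th N m od 0 = initial_blocks N m od"
| "blocks_at th N m od (Suc l) =
     (\<Union>B\<in>blocks_at th N m od l. if crosses th N m od B then quarters B else {B})"

definition num_levels :: "algorithm \<Rightarrow> (nat \<Rightarrow> real) \<Rightarrow> nat \<Rightarrow> int \<Rightarrow> bool \<Rightarrow> nat" where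
  "num_levels P th N m od = (LEAST l. \<forall>B\<in>blocks_at th N m od l.
     crosses th N m od B \<longrightarrow> height B < min_size P \<or> width B < min_size P)"

definition final_blocks :: "algorithm \<Rightarrow> (nat \<Rightarrow> real) \<Rightarrow> nat \<Rightarrow> int \<Rightarrow> bool \<Rightarrow> block set" where
  "final_blocks P th N m od = blocks_at th N m od (num_levels P th N m od)"

definition examined_blocks :: "algorithm \<Rightarrow> (nat \<Rightarrow> real) \<Rightarrow> nat \<Rightarrow> int \<Rightarrow> bool \<Rightarrow> block set" where
  "examined_blocks P th N m od = (\<Union>l\<le>num_levels P th N m od. blocks_at th N m od l)"

text \<open>Sum over the final blocks of a cost depending on the treatment of the block: butterfly for
  oscillatory blocks, low-rank for the trimmed non-oscillatory blocks (nothing if nothing is left),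
  direct for the reduced blocks on the curve.\<close>
definition total_cost ::
  "algorithm \<Rightarrow> (nat \<Rightarrow> real) \<Rightarrow> nat \<Rightarrow> int \<Rightarrow> bool \<Rightarrow>
   (complex mat \<Rightarrow> nat) \<Rightarrow> (complex mat \<Rightarrow> nat) \<Rightarrow> (complex mat \<Rightarrow> nat) \<Rightarrow> nat" where
  "total_cost P th N m od f g h =
     (\<Sum>B\<in>final_blocks P th N m od.
        let K = block_mat (alt_mat th N m od) B;
            T = block_mat K (trim P K);
            D = block_mat K (reduce P K)
        in if osc_block th N m od B then f K
           else if nonosc_block th N m od B then (if cells (trim P K) = {} then 0 else g T)
           else h D)"

definition bookkeeping_cost :: "algorithm \<Rightarrow> (nat \<Rightarrow> real) \<Rightarrow> nat \<Rightarrow> int \<Rightarrow> bool \<Rightarrow> nat" where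
  "bookkeeping_cost P th N m od = (\<Sum>B\<in>examined_blocks P th N m od. bookkeeping P N m od B)"

definition precomputation_time :: "algorithm \<Rightarrow> (nat \<Rightarrow> real) \<Rightarrow> nat \<Rightarrow> int \<Rightarrow> bool \<Rightarrow> nat" where
  "precomputation_time P th N m od = bookkeeping_cost P th N m od +
     total_cost P th N m od
       (build_time (idbf P) (entry_cost P))
       (build_time (lowrank P) (entry_cost P))
       (\<lambda>D. entry_cost P * (dim_row D * dim_col D))"

text \<open>The direct product of a \<open>p \<times> q\<close> block takes \<open>p q\<close> multiplications and at most as many
  additions; the last sum counts the accumulation of the contributions of the blocks.\<close>
definition application_time :: "algorithm \<Rightarrow> (nat \<Rightarrow> real) \<Rightarrow> nat \<Rightarrow> int \<Rightarrow> bool \<Rightarrow> nat" where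
  "application_time P th N m od =
     total_cost P th N m od (apply_time (idbf P)) (apply_time (lowrank P))
       (\<lambda>D. 2 * (dim_row D * dim_col D)) +
     (\<Sum>B\<in>final_blocks P th N m od. height B)"

definition precomputation_memory :: "algorithm \<Rightarrow> (nat \<Rightarrow> real) \<Rightarrow> nat \<Rightarrow> int \<Rightarrow> bool \<Rightarrow> nat" where
  "precomputation_memory P th N m od = bookkeeping_cost P th N m od +
     total_cost P th N m od (build_mem (idbf P)) (build_mem (lowrank P))
       (\<lambda>D. dim_row D * dim_col D)"

text \<open>The last two terms are the output and the input vector.\<close>
definition application_memory :: "algorithm \<Rightarrow> (nat \<Rightarrow> real) \<Rightarrow> nat \<Rightarrow> int \<Rightarrow> bool \<Rightarrow> nat" where
  "application_memory P th N m od =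
     total_cost P th N m od (apply_mem (idbf P)) (apply_mem (lowrank P))
       (\<lambda>D. dim_row D * dim_col D) +
     N + num_cols N m od"

definition time_complexity :: "algorithm \<Rightarrow> (nat \<Rightarrow> real) \<Rightarrow> nat \<Rightarrow> int \<Rightarrow> bool \<Rightarrow> nat" where
  "time_complexity P th N m od = precomputation_time P th N m od + application_time P th N m od"

definition memory_complexity :: "algorithm \<Rightarrow> (nat \<Rightarrow> real) \<Rightarrow> nat \<Rightarrow> int \<Rightarrow> bool \<Rightarrow> nat" where
  "memory_complexity P th N m od =
     precomputation_memory P th N m od + application_memory P th N m od"

subsection \<open>The rank bound\<close>

definition block_ranks :: "real \<Rightarrow> algorithm \<Rightarrow> (nat \<Rightarrow> real) \<Rightarrow> nat \<Rightarrow> int \<Rightarrow> bool \<Rightarrow> nat set" where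
  "block_ranks \<epsilon> P th N m od =
     {numerical_rank \<epsilon> (block_mat (alt_mat th N m od) B) | B.
        B \<in> final_blocks P th N m od \<and> nonosc_block th N m od B} \<union>
     {numerical_rank \<epsilon> S | S B.
        B \<in> final_blocks P th N m od \<and> osc_block th N m od B \<and>
        S \<in> relevant_subblocks (depth P) (block_mat (alt_mat th N m od) B)}"

definition matrix_rank_bound :: "real \<Rightarrow> algorithm \<Rightarrow> (nat \<Rightarrow> real) \<Rightarrow> nat \<Rightarrow> int \<Rightarrow> bool \<Rightarrow> nat" where
  "matrix_rank_bound \<epsilon> P th N m od = Sup (block_ranks \<epsilon> P th N m od)"

definition rank_bound :: "real \<Rightarrow> algorithm \<Rightarrow> (nat \<Rightarrow> real) \<Rightarrow> nat \<Rightarrow> nat" where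
  "rank_bound \<epsilon> P th N = Sup (\<Union>(m, od)\<in>{(m, od). admissible N m od}. block_ranks \<epsilon> P th N m od)"

end

theory Submission
  imports Defs
begin

text \<open>
  The weight of a block is its height plus its width. The total weight of all blocks ever
  examined is \<open>O(N log N)\<close>, and each final block costs at most \<open>O(r\<^sup>2 log N)\<close> per unit of weight;
  the product is the claimed bound.

  Weight. Along the turning point curve the angle decreases as the degree grows. If the rows are read
  in order of increasing angle, then of two crossing blocks of the same level neither lies strictly
  before the other one in both coordinates. A set of pairs without strictly comparable elements in a
  grid with \<open>p\<close> rows and \<open>q\<close> columns has at most \<open>p + q\<close> elements (\<open>card_le_no_strict_chain\<close>).
  With \<open>b\<close> initial row groups there are therefore at most \<open>(b + 1) 2\<^sup>l\<close> crossing blocks at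
  level \<open>l\<close>, whereas the initial blocks are nearly square with sides about \<open>N / b\<close>, so that a
  crossing block of level \<open>l\<close> has weight \<open>O(N / (b 2\<^sup>l) + 1)\<close>. As long as the partitioning
  continues, some crossing block is at least two rows high, which forces \<open>2\<^sup>l < N / b\<close>. Hence every
  level adds weight \<open>O(N)\<close>, and
  there are \<open>O(log N)\<close> levels (\<open>sum_weight_examined_le\<close>).

  Cost per unit of weight. Oscillatory blocks have bounded aspect ratio (\<open>block_props\<close>), so the
  butterfly bound applies to them. The trimmed part of a non-oscillatory block is a submatrix, and
  neither the rank nor the spectral norm grows when passing to a submatrix, so its numerical rank is
  at most that of the whole block (\<open>numerical_rank_submatrix_le\<close>). A final crossing block has a
  side of bounded length, so the number of its entries is at most a constant times its weight
  (\<open>crossing_entries_le\<close>).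

  The rank bound \<open>r\<close> of a single matrix may be zero and is replaced by \<open>max 1 r\<close>. This is not
  needed for the bound over all orders: for \<open>m = 0\<close> the even matrix contains the constant column
  \<open>1 / sqrt 2\<close> of degree zero, whose norm \<open>sqrt (N / 2)\<close> exceeds \<open>\<epsilon>\<close> for large \<open>N\<close>, so
  that the relevant subblock consisting of all rows and the first column leaf has numerical rank at
  least one (\<open>rank_bound_pos\<close>).
\<close>

unbundle no vec_syntax

section \<open>Numerical rank of submatrices\<close>

lemma vec_norm2_nonneg [simp]: "0 \<le> vec_norm2 v"
  by (simp add: vec_norm2_def)

lemma spectral_norm_bdd_above:
  "bdd_above {vec_norm2 (A *\<^sub>v v) | v. v \<in> carrier_vec (dim_col A) \<and> vec_norm2 v \<le> 1}"
proof (rule bdd_aboveI)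
  fix x assume "x \<in> {vec_norm2 (A *\<^sub>v v) | v. v \<in> carrier_vec (dim_col A) \<and> vec_norm2 v \<le> 1}"
  then obtain v where x: "x = vec_norm2 (A *\<^sub>v v)" and v: "v \<in> carrier_vec (dim_col A)"
    and n: "vec_norm2 v \<le> 1" by blast
  have vj: "cmod (v $ j) \<le> 1" if "j < dim_col A" for j
    using member_le_L2_set[of "{..<dim_vec v}" j "\<lambda>i. cmod (v $ i)"] v n that
    unfolding vec_norm2_def by auto
  have "x \<le> (\<Sum>i<dim_row A. \<bar>cmod ((A *\<^sub>v v) $ i)\<bar>)"
    unfolding x vec_norm2_def by (simp add: L2_set_le_sum del: index_mult_mat_vec)
  also have "\<dots> \<le> (\<Sum>i<dim_row A. \<Sum>j<dim_col A. cmod (A $$ (i, j)))"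
  proof (rule sum_mono)
    fix i assume i: "i \<in> {..<dim_row A}"
    have "(A *\<^sub>v v) $ i = (\<Sum>j<dim_col A. A $$ (i, j) * v $ j)"
      using i v by (simp add: scalar_prod_def atLeast0LessThan)
    also have "cmod \<dots> \<le> (\<Sum>j<dim_col A. cmod (A $$ (i, j) * v $ j))" by (rule norm_sum)
    also have "\<dots> \<le> (\<Sum>j<dim_col A. cmod (A $$ (i, j)))"
      using vj by (intro sum_mono) (simp add: norm_mult mult_left_le)
    finally show "\<bar>cmod ((A *\<^sub>v v) $ i)\<bar> \<le> (\<Sum>j<dim_col A. cmod (A $$ (i, j)))" by simp
  qed
  finally show "x \<le> (\<Sum>i<dim_row A. \<Sum>j<dim_col A. cmod (A $$ (i, j)))" .
qed

lemma vec_norm2_mult_le_spectral_norm: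
  assumes "v \<in> carrier_vec (dim_col A)" "vec_norm2 v \<le> 1"
  shows "vec_norm2 (A *\<^sub>v v) \<le> spectral_norm A"
  unfolding spectral_norm_def using assms by (intro cSup_upper spectral_norm_bdd_above) blast

lemma spectral_norm_leI:
  assumes "\<And>v. v \<in> carrier_vec (dim_col A) \<Longrightarrow> vec_norm2 v \<le> 1 \<Longrightarrow> vec_norm2 (A *\<^sub>v v) \<le> c"
  shows "spectral_norm A \<le> c"
  unfolding spectral_norm_def
proof (rule cSup_least)
  have "vec_norm2 (0\<^sub>v (dim_col A)) \<le> 1" by (simp add: vec_norm2_def L2_set_def)
  then show "{vec_norm2 (A *\<^sub>v v) | v. v \<in> carrier_vec (dim_col A) \<and> vec_norm2 v \<le> 1} \<noteq> {}"
    using zero_carrier_vec by blast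
qed (use assms in blast)

lemma spectral_norm_diff_self: "spectral_norm (A - A) = 0"
proof -
  have 0: "vec_norm2 ((A - A) *\<^sub>v v) = 0" if "v \<in> carrier_vec (dim_col A)" for v
    using that by (simp add: vec_norm2_def L2_set_def scalar_prod_def)
  have v: "vec_norm2 (0\<^sub>v (dim_col A)) \<le> 1" by (simp add: vec_norm2_def L2_set_def)
  have "spectral_norm (A - A) \<le> 0" using 0 by (intro spectral_norm_leI) simp
  moreover have "0 \<le> spectral_norm (A - A)"
    using vec_norm2_mult_le_spectral_norm[of "0\<^sub>v (dim_col A)" "A - A"] v by (simp add: order_trans[rotated])
  ultimately show ?thesis by simp
qed

lemma pick_inj_on: "inj_on (pick I) {..<card {i. i < n \<and> i \<in> I}}"
proof -
  have "pick I i \<noteq> pick I j" if "i < j" "j < card {i. i < n \<and> i \<in> I}" for i j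
  proof -
    have "finite I \<Longrightarrow> card {i. i < n \<and> i \<in> I} \<le> card I" by (intro card_mono) auto
    then show ?thesis using pick_mono[of j I i] that by force
  qed
  then show ?thesis by (metis (no_types, lifting) inj_onI lessThan_iff linorder_neqE_nat)
qed

lemma spectral_norm_submatrix_le: "spectral_norm (submatrix A I J) \<le> spectral_norm A"
proof (rule spectral_norm_leI)
  define n where "n = card {i. i < dim_row A \<and> i \<in> I}"
  define m where "m = card {j. j < dim_col A \<and> j \<in> J}"
  let ?S = "submatrix A I J" and ?g = "pick J" and ?f = "pick I"
  fix v assume v: "v \<in> carrier_vec (dim_col ?S)" and nv: "vec_norm2 v \<le> 1"
  have vm: "dim_vec v = m" using v by (simp add: dim_submatrix m_def)
  have g: "inj_on ?g {..<m}" and f: "inj_on ?f {..<n}" unfolding m_def n_def by (rule pick_inj_on)+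
  have gm: "?g ` {..<m} \<subseteq> {..<dim_col A}" and fn: "?f ` {..<n} \<subseteq> {..<dim_row A}"
    unfolding m_def n_def using pick_le by blast+
  define h where "h = the_inv_into {..<m} ?g"
  \<comment> \<open>Extension of the vector by zero outside the selected columns.\<close>
  define w where "w = vec (dim_col A) (\<lambda>j. if j \<in> ?g ` {..<m} then v $ h j else 0)"
  have hg: "h (?g j) = j" if "j < m" for j
    using that g by (simp add: h_def the_inv_into_f_f)
  have wg: "w $ ?g j = v $ j" if "j < m" for j
    using that gm hg unfolding w_def by (subst index_vec) auto
  have w0: "w $ j = 0" if "j < dim_col A" "j \<notin> ?g ` {..<m}" for j
    using that by (simp add: w_def)
  have w: "w \<in> carrier_vec (dim_col A)" by (simp add: w_def)
  have nw: "vec_norm2 w = vec_norm2 v"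
  proof -
    have "(\<Sum>j<dim_col A. (cmod (w $ j))\<^sup>2) = (\<Sum>j\<in>?g ` {..<m}. (cmod (w $ j))\<^sup>2)"
      using gm w0 by (intro sum.mono_neutral_right) auto
    also have "\<dots> = (\<Sum>j<m. (cmod (v $ j))\<^sup>2)"
      using wg by (subst sum.reindex[OF g]) simp
    finally show ?thesis using w vm by (simp add: vec_norm2_def L2_set_def)
  qed
  have eq: "(?S *\<^sub>v v) $ i = (A *\<^sub>v w) $ ?f i" if i: "i < n" for i
  proof -
    have "?f i < dim_row A" using i fn by blast
    then have "(A *\<^sub>v w) $ ?f i = (\<Sum>j<dim_col A. A $$ (?f i, j) * w $ j)"
      using w by (simp add: scalar_prod_def atLeast0LessThan)
    also have "\<dots> = (\<Sum>j\<in>?g ` {..<m}. A $$ (?f i, j) * w $ j)"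
      using gm w0 by (intro sum.mono_neutral_right) auto
    also have "\<dots> = (\<Sum>j<m. A $$ (?f i, ?g j) * v $ j)"
      using wg by (subst sum.reindex[OF g]) simp
    also have "\<dots> = (?S *\<^sub>v v) $ i"
      using i vm by (simp add: submatrix_def n_def m_def scalar_prod_def atLeast0LessThan)
    finally show ?thesis by simp
  qed
  have "vec_norm2 (?S *\<^sub>v v) = sqrt (\<Sum>i<n. (cmod ((A *\<^sub>v w) $ ?f i))\<^sup>2)"
    using eq by (simp add: vec_norm2_def L2_set_def dim_submatrix n_def)
  also have "\<dots> = sqrt (\<Sum>i\<in>?f ` {..<n}. (cmod ((A *\<^sub>v w) $ i))\<^sup>2)"
    by (subst sum.reindex[OF f]) simp
  also have "\<dots> \<le> sqrt (\<Sum>i<dim_row A. (cmod ((A *\<^sub>v w) $ i))\<^sup>2)"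
    using fn by (intro real_sqrt_le_mono sum_mono2) auto
  also have "\<dots> = vec_norm2 (A *\<^sub>v w)" by (simp add: vec_norm2_def L2_set_def)
  also have "\<dots> \<le> spectral_norm A"
    using w nw nv by (intro vec_norm2_mult_le_spectral_norm) auto
  finally show "vec_norm2 (?S *\<^sub>v v) \<le> spectral_norm A" .
qed

text \<open>Independent columns of the submatrix are restrictions of columns of the whole matrix, which
  are independent because a linear relation between them restricts to the selected rows.\<close>

lemma rank_submatrix_le:
  fixes A :: "'a :: field mat"
  shows "vec_space.rank (dim_row (submatrix A I J)) (submatrix A I J) \<le> vec_space.rank (dim_row A) A"
proof -
  let ?S = "submatrix A I J" and ?n = "dim_row (submatrix A I J)" and ?N = "dim_row A"
  interpret S: vec_space "TYPE('a)" ?n .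
  interpret A: vec_space "TYPE('a)" ?N .
  have S: "?S \<in> carrier_mat ?n (dim_col ?S)" and A: "A \<in> carrier_mat ?N (dim_col A)" by auto
  let ?P = "\<lambda>T. T \<subseteq> set (cols ?S) \<and> S.lin_indpt T"
  obtain U where U: "maximal U ?P"
    using maximal_exists[of ?P "card (set (cols ?S))" "{}"]
    by (meson List.finite_set S.finite_lin_indpt2 card_mono empty_iff empty_subsetI finite_subset)
  then have UP: "U \<subseteq> set (cols ?S)" "S.lin_indpt U" by (auto simp: maximal_def)
  obtain us where us: "set us = U" "distinct us"
    using UP(1) by (meson List.finite_set finite_distinct_list finite_subset)
  have "\<forall>u\<in>U. \<exists>j<dim_col ?S. u = col ?S j"
    using UP(1) by (force simp: cols_def)
  then obtain c where c: "\<And>u. u \<in> U \<Longrightarrow> c u < dim_col ?S \<and> u = col ?S (c u)" by metis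
  define lift where "lift u = col A (pick J (c u))" for u
  have pJ: "pick J (c u) < dim_col A" if "u \<in> U" for u
    using c[OF that] by (intro pick_le) (simp add: dim_submatrix)
  have pI: "pick I i < ?N" if "i < ?n" for i
    using that by (intro pick_le) (simp add: dim_submatrix)
  have res: "lift u $ pick I i = u $ i" if "u \<in> U" "i < ?n" for u i
  proof -
    have "u $ i = ?S $$ (i, c u)" using c[OF that(1)] that(2) by (metis index_col)
    also have "\<dots> = A $$ (pick I i, pick J (c u))"
      using c[OF that(1)] that(2) by (intro submatrix_index) (auto simp: dim_submatrix)
    also have "\<dots> = lift u $ pick I i" using pI[OF that(2)] pJ[OF that(1)] by (simp add: lift_def)
    finally show ?thesis by simp
  qed
  have dU: "u \<in> carrier_vec ?n" if "u \<in> U" for u using c[OF that] by (metis col_dim)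
  have inj: "inj_on lift U"
  proof (rule inj_onI)
    fix x y assume "x \<in> U" "y \<in> U" "lift x = lift y"
    then show "x = y" using res dU by (intro eq_vecI) (metis carrier_vecD)+
  qed
  define k where "k = length us"
  let ?M = "mat_of_cols ?N (map lift us)" and ?M' = "mat_of_cols ?n us"
  have lc: "lift u \<in> carrier_vec ?N" for u by (simp add: lift_def)
  have colsM: "cols ?M = map lift us" using lc by (intro cols_mat_of_cols) auto
  have colsM': "cols ?M' = us" using dU us by (intro cols_mat_of_cols) auto
  have M: "?M \<in> carrier_mat ?N k" "?M' \<in> carrier_mat ?n k" by (auto simp: k_def)
  have "A.lin_indpt (lift ` U)"
  proof
    assume "A.lin_dep (lift ` U)"
    then have "A.lin_dep (set (cols ?M))" using colsM us by simp
    moreover have "distinct (cols ?M)" using colsM us inj by (simp add: distinct_map)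
    ultimately obtain v where v: "v \<in> carrier_vec k" "v \<noteq> 0\<^sub>v k" "?M *\<^sub>v v = 0\<^sub>v ?N"
      using A.lin_depE[OF M(1)] by metis
    have "?M' *\<^sub>v v = 0\<^sub>v ?n"
    proof (rule eq_vecI)
      fix i assume "i < dim_vec (0\<^sub>v ?n :: 'a vec)"
      then have i: "i < ?n" by simp
      have "(?M' *\<^sub>v v) $ i = (\<Sum>j<k. us ! j $ i * v $ j)"
        using i v(1) by (simp add: scalar_prod_def mat_of_cols_index k_def atLeast0LessThan)
      also have "\<dots> = (\<Sum>j<k. lift (us ! j) $ pick I i * v $ j)"
        using i us by (intro sum.cong refl) (simp add: res k_def flip: us(1))
      also have "\<dots> = (?M *\<^sub>v v) $ pick I i"
        using pI[OF i] v(1) by (simp add: scalar_prod_def mat_of_cols_index k_def atLeast0LessThan)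
      also have "\<dots> = 0" using v(3) pI[OF i] by simp
      finally show "(?M' *\<^sub>v v) $ i = 0\<^sub>v ?n $ i" using i by simp
    qed simp
    then have "S.lin_dep (set (cols ?M'))"
      using v colsM' us by (intro S.lin_depI[OF M(2)]) auto
    then show False using UP(2) colsM' us by simp
  qed
  moreover have "lift ` U \<subseteq> set (cols A)" using pJ by (auto simp: lift_def cols_def)
  ultimately have "card (lift ` U) \<le> A.rank A" by (intro A.rank_ge_card_indpt[OF A])
  then show ?thesis using S.rank_card_indpt[OF S U] card_image[OF inj] by simp
qed

lemma numerical_rank_le:
  assumes "X \<in> carrier_mat (dim_row A) (dim_col A)" "spectral_norm (A - X) \<le> \<epsilon>"
  shows "numerical_rank \<epsilon> A \<le> vec_space.rank (dim_row A) X"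
  unfolding numerical_rank_def using assms by (intro Least_le) blast

lemma numerical_rank_attained:
  assumes "0 \<le> \<epsilon>"
  obtains X where "X \<in> carrier_mat (dim_row A) (dim_col A)"
    "vec_space.rank (dim_row A) X = numerical_rank \<epsilon> A" "spectral_norm (A - X) \<le> \<epsilon>"
proof -
  have "\<exists>k. \<exists>X\<in>carrier_mat (dim_row A) (dim_col A).
      vec_space.rank (dim_row A) X = k \<and> spectral_norm (A - X) \<le> \<epsilon>"
    using assms by (intro exI bexI[of _ A]) (auto simp: spectral_norm_diff_self)
  from LeastI_ex[OF this] show ?thesis using that unfolding numerical_rank_def by blast
qed

lemma numerical_rank_le_dim_col:
  assumes "0 \<le> \<epsilon>"
  shows "numerical_rank \<epsilon> A \<le> dim_col A"
proof -
  have "numerical_rank \<epsilon> A \<le> vec_space.rank (dim_row A) A"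
    using assms by (intro numerical_rank_le) (auto simp: spectral_norm_diff_self)
  also have "\<dots> \<le> dim_col A" by (rule vec_space.rank_le_nc) auto
  finally show ?thesis .
qed

lemma submatrix_minus:
  assumes "X \<in> carrier_mat (dim_row A) (dim_col A)"
  shows "submatrix (A - X) I J = submatrix A I J - submatrix X I J"
  using assms pick_le by (intro eq_matI) (auto simp: submatrix_def)

lemma numerical_rank_submatrix_le:
  assumes "0 \<le> \<epsilon>"
  shows "numerical_rank \<epsilon> (submatrix A I J) \<le> numerical_rank \<epsilon> A"
proof -
  obtain X where X: "X \<in> carrier_mat (dim_row A) (dim_col A)"
    "vec_space.rank (dim_row A) X = numerical_rank \<epsilon> A" "spectral_norm (A - X) \<le> \<epsilon>"
    using numerical_rank_attained[OF assms] .
  have d: "dim_row (submatrix X I J) = dim_row (submatrix A I J)"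
    "dim_col (submatrix X I J) = dim_col (submatrix A I J)" "dim_row X = dim_row A"
    using X(1) by (auto simp: dim_submatrix)
  have "spectral_norm (submatrix A I J - submatrix X I J) \<le> \<epsilon>"
    using spectral_norm_submatrix_le[of "A - X" I J] X by (simp add: submatrix_minus)
  then have "numerical_rank \<epsilon> (submatrix A I J)
      \<le> vec_space.rank (dim_row (submatrix A I J)) (submatrix X I J)"
    using d by (intro numerical_rank_le) auto
  also have "\<dots> \<le> numerical_rank \<epsilon> A" using rank_submatrix_le[of X I J] d X by simp
  finally show ?thesis .
qed

lemma rank_0_entry:
  fixes X :: "'a :: field mat"
  assumes "vec_space.rank (dim_row X) X = 0" "i < dim_row X" "j < dim_col X"
  shows "X $$ (i, j) = 0"
proof (rule ccontr)
  assume nz: "X $$ (i, j) \<noteq> 0"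
  have ij: "{a. a < dim_row X \<and> a \<in> {i}} = {i}" "{a. a < dim_col X \<and> a \<in> {j}} = {j}"
    using assms by auto
  have "submatrix X {i} {j} $$ (0, 0) = X $$ (i, j)"
    using submatrix_index_card[of i X j "{i}" "{j}"] assms by (simp cong: conj_cong)
  moreover have "submatrix X {i} {j} \<in> carrier_mat 1 1"
    by (intro carrier_matI) (simp_all only: dim_submatrix ij, simp_all)
  ultimately have "det (submatrix X {i} {j}) \<noteq> 0" using nz by (simp add: det_single)
  from vec_space.rank_gt_minor[OF _ this, of "dim_row X" "dim_col X"]
  show False using assms ij by auto
qed

text \<open>A matrix which has a column of norm greater than \<open>\<epsilon>\<close> is not numerically zero.\<close>

lemma numerical_rank_pos:
  assumes \<epsilon>: "0 \<le> \<epsilon>" and j: "j < dim_col A"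
    and norm: "\<epsilon>\<^sup>2 < (\<Sum>i<dim_row A. (cmod (A $$ (i, j)))\<^sup>2)"
  shows "1 \<le> numerical_rank \<epsilon> A"
proof (rule ccontr)
  assume "\<not> 1 \<le> numerical_rank \<epsilon> A"
  then obtain X where X: "X \<in> carrier_mat (dim_row A) (dim_col A)"
    "vec_space.rank (dim_row A) X = 0" "spectral_norm (A - X) \<le> \<epsilon>"
    using numerical_rank_attained[OF \<epsilon>, of A] by (metis less_one linorder_not_le)
  define e :: "complex vec" where "e = unit_vec (dim_col A) j"
  have e: "e \<in> carrier_vec (dim_col (A - X))" using X by (simp add: e_def)
  have "(\<Sum>i<dim_col A. (cmod (e $ i))\<^sup>2) = (\<Sum>i<dim_col A. if i = j then 1 else 0)"
    by (intro sum.cong refl) (simp add: e_def unit_vec_def)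
  then have n: "vec_norm2 e \<le> 1" using j by (simp add: vec_norm2_def L2_set_def e_def)
  have "((A - X) *\<^sub>v e) $ i = A $$ (i, j)" if i: "i < dim_row A" for i
  proof -
    have x0: "X $$ (i, j) = 0" using X i j by (intro rank_0_entry) auto
    have "((A - X) *\<^sub>v e) $ i = Matrix.row (A - X) i $ j"
      using X i j by (simp add: e_def scalar_prod_right_unit[of _ "dim_col A"])
    then show ?thesis using X i j x0 by simp
  qed
  then have "vec_norm2 ((A - X) *\<^sub>v e) = sqrt (\<Sum>i<dim_row A. (cmod (A $$ (i, j)))\<^sup>2)"
    using X by (simp add: vec_norm2_def L2_set_def)
  then have "\<epsilon> < vec_norm2 ((A - X) *\<^sub>v e)"
    using norm \<epsilon> by (simp add: real_less_rsqrt)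
  moreover have "vec_norm2 ((A - X) *\<^sub>v e) \<le> spectral_norm (A - X)"
    by (rule vec_norm2_mult_le_spectral_norm[OF e n])
  ultimately show False using X(3) by simp
qed

section \<open>Recursive bisection of index ranges\<close>

lemma card_indices: "card (indices R) = snd R - fst R"
  by (simp add: indices_def)

lemma indices_nonempty_iff: "indices R \<noteq> {} \<longleftrightarrow> fst R < snd R"
  by (simp add: indices_def)

lemma cells_nonempty_iff: "cells B \<noteq> {} \<longleftrightarrow> indices (fst B) \<noteq> {} \<and> indices (snd B) \<noteq> {}"
  by (auto simp: cells_def)

text \<open>The nonempty ranges obtained from the ranges in \<open>S\<close> after \<open>l\<close> bisections.\<close>

primrec split_level :: "range set \<Rightarrow> nat \<Rightarrow> range set" where
  "split_level S 0 = {R \<in> S. indices R \<noteq> {}}"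
| "split_level S (Suc l) = {R \<in> (\<Union>R'\<in>split_level S l. halves R'). indices R \<noteq> {}}"

text \<open>Distinct ranges of the set do not overlap.\<close>

definition separated :: "range set \<Rightarrow> bool" where
  "separated S \<longleftrightarrow> (\<forall>R\<in>S. \<forall>R'\<in>S. R \<noteq> R' \<longrightarrow> snd R \<le> fst R' \<or> snd R' \<le> fst R)"

lemma split_level_nonempty: "R \<in> split_level S l \<Longrightarrow> fst R < snd R"
  by (cases l) (auto simp: indices_nonempty_iff)

lemma finite_halves: "finite (halves R)" and card_halves_le: "card (halves R) \<le> 2"
  by (auto simp: halves_def card_insert_if split: prod.split)

lemma finite_split_level: "finite S \<Longrightarrow> finite (split_level S l)"
  by (induction l) (auto simp: finite_halves)

lemma card_split_level_le:
  assumes "finite S"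
  shows "card (split_level S l) \<le> 2 ^ l * card S"
proof (induction l)
  case 0
  show ?case using assms by (auto intro: card_mono)
next
  case (Suc l)
  have fin: "finite (split_level S l)" using assms by (rule finite_split_level)
  have "card (split_level S (Suc l)) \<le> card (\<Union>R'\<in>split_level S l. halves R')"
    using fin by (intro card_mono) (auto simp: finite_halves)
  also have "\<dots> \<le> (\<Sum>R'\<in>split_level S l. card (halves R'))" using fin by (rule card_UN_le)
  also have "\<dots> \<le> card (split_level S l) * 2"
    using sum_bounded_above[of "split_level S l" "\<lambda>R. card (halves R)" 2] card_halves_le by simp
  finally show ?case using Suc by simp
qed

lemma halves_bounds:
  assumes "R' \<in> halves R" "fst R < snd R"
  shows "fst R \<le> fst R'" "snd R' \<le> snd R" "fst R' \<le> snd R'"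
  using assms by (auto simp: halves_def split: prod.splits)

lemma separated_split_level:
  assumes "separated S"
  shows "separated (split_level S l)"
proof (induction l)
  case 0
  show ?case using assms by (auto simp: separated_def)
next
  case (Suc l)
  show ?case unfolding separated_def
  proof (intro ballI impI)
    fix R R' assume "R \<in> split_level S (Suc l)" "R' \<in> split_level S (Suc l)" and ne: "R \<noteq> R'"
    then obtain Q Q' where Q: "Q \<in> split_level S l" "R \<in> halves Q"
      and Q': "Q' \<in> split_level S l" "R' \<in> halves Q'" by auto
    have b: "fst Q \<le> fst R" "snd R \<le> snd Q" "fst Q' \<le> fst R'" "snd R' \<le> snd Q'"
      using halves_bounds Q Q' split_level_nonempty by blast+
    show "snd R \<le> fst R' \<or> snd R' \<le> fst R"
    proof (cases "Q = Q'")
      case True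
      then show ?thesis using Q Q' ne by (auto simp: halves_def split: prod.splits)
    next
      case False
      then have "snd Q \<le> fst Q' \<or> snd Q' \<le> fst Q"
        using Suc Q Q' by (auto simp: separated_def)
      then show ?thesis using b by linarith
    qed
  qed
qed

lemma split_level_subset:
  assumes "\<And>R. R \<in> S \<Longrightarrow> indices R \<subseteq> T" "R \<in> split_level S l"
  shows "indices R \<subseteq> T"
  using assms(2)
proof (induction l arbitrary: R)
  case 0
  then show ?case using assms(1) by auto
next
  case (Suc l)
  then obtain Q where Q: "Q \<in> split_level S l" "R \<in> halves Q" by auto
  have "indices R \<subseteq> indices Q"
    using halves_bounds[OF Q(2) split_level_nonempty[OF Q(1)]] by (simp add: indices_def)
  then show ?case using Suc.IH[OF Q(1)] by blast
qed

text \<open>Rounding errors do not accumulate: if all ranges have length \<open>x\<close> up to an error below one,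
  then after \<open>l\<close> bisections all have length \<open>x / 2 ^ l\<close> up to an error below one.\<close>

lemma split_level_length:
  assumes "\<And>R. R \<in> S \<Longrightarrow> \<bar>real (card (indices R)) - x\<bar> < 1" "R \<in> split_level S l"
  shows "\<bar>real (card (indices R)) - x / 2 ^ l\<bar> < 1"
  using assms(2)
proof (induction l arbitrary: R)
  case 0
  then show ?case using assms(1) by auto
next
  case (Suc l)
  then obtain Q where Q: "Q \<in> split_level S l" "R \<in> halves Q" by auto
  have c: "card (indices R) = card (indices Q) div 2
    \<or> card (indices R) = card (indices Q) - card (indices Q) div 2"
    using Q(2) by (auto simp: halves_def card_indices split: prod.splits)
  define y where "y = x / 2 ^ l"
  have "\<bar>real (card (indices Q)) - y\<bar> < 1" using Suc.IH[OF Q(1)] by (simp add: y_def)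
  moreover have "2 * card (indices R) \<le> card (indices Q) + 1" "card (indices Q) \<le> 2 * card (indices R) + 1"
    using c by presburger+
  then have "2 * real (card (indices R)) \<le> real (card (indices Q)) + 1"
    "real (card (indices Q)) \<le> 2 * real (card (indices R)) + 1" by linarith+
  ultimately have "\<bar>real (card (indices R)) - y / 2\<bar> < 1" by linarith
  then show ?case by (simp add: y_def mult.commute)
qed

section \<open>Staircases in a grid\<close>

text \<open>If \<open>rA\<close> and \<open>rB\<close> denote the ranks in \<open>A\<close> and \<open>B\<close>, then \<open>rA a - rB b\<close> is injective on a set
  without two strictly comparable pairs, and it takes at most \<open>card A + card B\<close> values.\<close>

lemma card_le_no_strict_chain:
  fixes f :: "'a \<Rightarrow> int" and g :: "'b \<Rightarrow> int"
  assumes fin: "finite A" "finite B" and S: "S \<subseteq> A \<times> B" and inj: "inj_on f A" "inj_on g B"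
    and no_chain: "\<And>a b a' b'. (a, b) \<in> S \<Longrightarrow> (a', b') \<in> S \<Longrightarrow> \<not> (f a < f a' \<and> g b < g b')"
  shows "card S \<le> card A + card B"
proof -
  define rA where "rA a = card {x \<in> A. f x < f a}" for a
  define rB where "rB b = card {x \<in> B. g x < g b}" for b
  have lA: "rA a < card A" if "a \<in> A" for a
    unfolding rA_def using that fin by (intro psubset_card_mono) auto
  have lB: "rB b < card B" if "b \<in> B" for b
    unfolding rB_def using that fin by (intro psubset_card_mono) auto
  have mA: "rA a < rA a' \<longleftrightarrow> f a < f a'" if "a \<in> A" "a' \<in> A" for a a'
  proof
    assume "f a < f a'"
    then show "rA a < rA a'"
      unfolding rA_def using that fin by (intro psubset_card_mono) auto
  next
    assume "rA a < rA a'"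
    show "f a < f a'"
    proof (rule ccontr)
      assume "\<not> f a < f a'"
      then have "rA a' \<le> rA a" unfolding rA_def using fin by (intro card_mono) auto
      with \<open>rA a < rA a'\<close> show False by simp
    qed
  qed
  have mB: "rB a < rB a' \<longleftrightarrow> g a < g a'" if "a \<in> B" "a' \<in> B" for a a'
  proof
    assume "g a < g a'"
    then show "rB a < rB a'"
      unfolding rB_def using that fin by (intro psubset_card_mono) auto
  next
    assume "rB a < rB a'"
    show "g a < g a'"
    proof (rule ccontr)
      assume "\<not> g a < g a'"
      then have "rB a' \<le> rB a" unfolding rB_def using fin by (intro card_mono) auto
      with \<open>rB a < rB a'\<close> show False by simp
    qed
  qed
  define h where "h p = int (rA (fst p)) - int (rB (snd p))" for p
  have "inj_on h S"
  proof (rule inj_onI)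
    fix p q assume p: "p \<in> S" and q: "q \<in> S" and eq: "h p = h q"
    have AB: "fst p \<in> A" "fst q \<in> A" "snd p \<in> B" "snd q \<in> B" using p q S by auto
    have "\<not> (f (fst p) < f (fst q) \<and> g (snd p) < g (snd q))"
      "\<not> (f (fst q) < f (fst p) \<and> g (snd q) < g (snd p))"
      using no_chain p q by (metis prod.collapse)+
    then have "rA (fst p) = rA (fst q)" "rB (snd p) = rB (snd q)"
      using mA[OF AB(1,2)] mA[OF AB(2,1)] mB[OF AB(3,4)] mB[OF AB(4,3)] eq
      unfolding h_def by linarith+
    then have "f (fst p) = f (fst q)" "g (snd p) = g (snd q)"
      using mA[OF AB(1,2)] mA[OF AB(2,1)] mB[OF AB(3,4)] mB[OF AB(4,3)] by linarith+
    then show "p = q" using AB inj by (metis inj_on_eq_iff prod_eqI)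
  qed
  moreover have "h ` S \<subseteq> {- int (card B)..<int (card A)}"
    using S lA lB by (force simp: h_def)
  ultimately have "card S \<le> card {- int (card B)..<int (card A)}"
    by (metis card_image card_mono finite_atLeastLessThan_int)
  then show ?thesis by simp
qed

section \<open>Columns and the turning point curve\<close>

lemma length_filter_parity:
  "length (filter (\<lambda>k. odd (k - a) = p) [a..<a + d]) = (if p then d div 2 else (d + 1) div 2)"
  by (induction d) (auto simp del: even_diff_nat)

lemma num_cols_le: "num_cols N m od \<le> N"
proof (cases "nat \<bar>m\<bar> \<le> 2 * N")
  case True
  then have "2 * N = nat \<bar>m\<bar> + (2 * N - nat \<bar>m\<bar>)" by simp
  then have "num_cols N m od = (if od then (2 * N - nat \<bar>m\<bar>) div 2 else (2 * N - nat \<bar>m\<bar> + 1) div 2)"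
    unfolding num_cols_def degrees_def using length_filter_parity by metis
  then show ?thesis by auto
qed (simp add: num_cols_def degrees_def)

lemma degrees_mono:
  assumes "i \<le> j" "j < num_cols N m od"
  shows "degrees N m od ! i \<le> degrees N m od ! j"
proof -
  have "sorted (degrees N m od)" unfolding degrees_def by (intro sorted_wrt_filter) simp
  then show ?thesis using assms by (simp add: sorted_nth_mono num_cols_def)
qed

lemma degrees_ge: "j < num_cols N m od \<Longrightarrow> nat \<bar>m\<bar> \<le> degrees N m od ! j"
  using nth_mem[of j "degrees N m od"] by (auto simp: num_cols_def degrees_def)

lemma turning_point_antimono:
  assumes "m \<noteq> 0" "nat \<bar>m\<bar> \<le> k" "k \<le> k'"
  shows "turning_point k' m \<le> turning_point k m"
proof -
  define s where "s = sqrt ((of_int m)\<^sup>2 - 1 / 4 :: real)"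
  have "1 \<le> \<bar>m\<bar>" using assms(1) by simp
  then have "1 \<le> \<bar>real_of_int m\<bar>" by (metis of_int_1_le_iff of_int_abs)
  then have "1 \<le> (real_of_int m)\<^sup>2" using abs_square_le_1 by (metis one_le_power power2_abs)
  then have s0: "0 \<le> s" by (simp add: s_def)
  have "\<bar>real_of_int m\<bar> \<le> real k" using assms(2) by linarith
  moreover have "s \<le> sqrt ((of_int m)\<^sup>2)" unfolding s_def by (intro real_sqrt_le_mono) simp
  ultimately have sk: "s \<le> real k + 1 / 2" by simp
  have "s / (real k' + 1 / 2) \<le> s / (real k + 1 / 2)"
    using s0 assms(3) by (intro divide_left_mono) (auto simp: add_pos_pos)
  moreover have "s / (real k + 1 / 2) \<le> 1" using sk by (simp add: divide_le_eq)
  moreover have "0 \<le> s / (real k' + 1 / 2)" using s0 by simp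
  ultimately show ?thesis unfolding turning_point_def s_def[symmetric]
    by (intro arcsin_le_arcsin) auto
qed

section \<open>Weight of the examined blocks\<close>

lemma sum_Union_le:
  fixes f :: "'a \<Rightarrow> nat"
  assumes "finite I" "\<And>i. i \<in> I \<Longrightarrow> finite (A i)"
  shows "sum f (\<Union>i\<in>I. A i) \<le> (\<Sum>i\<in>I. sum f (A i))"
  using assms
proof (induction I rule: finite_induct)
  case (insert i I)
  have "sum f (\<Union>i\<in>insert i I. A i) \<le> sum f (A i) + sum f (\<Union>i\<in>I. A i)"
    using insert.hyps insert.prems by (subst UN_insert, subst sum_Un_nat) auto
  then show ?case using insert by fastforce
qed simp

text \<open>Half the perimeter of a block. Splitting a block into quarters at most doubles the total weight.\<close>

definition weight :: "block \<Rightarrow> nat" where "weight B = height B + width B"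

lemma finite_quarters: "finite (quarters B)"
  unfolding quarters_def by (simp add: finite_halves)

lemma sum_weight_quarters_le: "sum weight (quarters B) \<le> 2 * weight B"
proof (cases "cells B = {}")
  case True
  have "quarters B = {}"
    using True by (cases B) (auto simp: quarters_def halves_def cells_def indices_def split: prod.splits)
  then show ?thesis by simp
next
  case False
  obtain a b c d where B: "B = ((a, b), (c, d))" by (metis surj_pair)
  have le: "a < b" "c < d" using False by (auto simp: B cells_def indices_def)
  define p where "p = a + (b - a) div 2"
  define q where "q = c + (d - c) div 2"
  have pq: "a \<le> p" "p \<le> b" "c \<le> q" "q \<le> d" using le by (auto simp: p_def q_def)
  have h: "sum f (halves (x, y)) \<le> f (x, x + (y - x) div 2) + f (x + (y - x) div 2, y)"
    for f :: "range \<Rightarrow> nat" and x y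
    by (auto simp: halves_def sum.insert_if)
  have "sum weight (quarters B) \<le> sum weight (halves (a, b) \<times> halves (c, d))"
    unfolding B quarters_def by (intro sum_mono2) (auto simp: finite_halves)
  also have "\<dots> = (\<Sum>R\<in>halves (a, b). \<Sum>C\<in>halves (c, d). weight (R, C))"
    by (simp add: sum.cartesian_product)
  also have "\<dots> \<le> (\<Sum>R\<in>halves (a, b). weight (R, (c, q)) + weight (R, (q, d)))"
    using h unfolding q_def by (intro sum_mono) blast
  also have "\<dots> \<le> weight ((a, p), (c, q)) + weight ((a, p), (q, d)) +
      (weight ((p, b), (c, q)) + weight ((p, b), (q, d)))"
    using h[of "\<lambda>R. weight (R, (c, q)) + weight (R, (q, d))"] unfolding p_def .
  also have "\<dots> = 2 * weight B"
    using pq by (simp add: weight_def height_def width_def card_indices B)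
  finally show ?thesis .
qed

text \<open>The partition of one ALT matrix: \<open>n\<close> columns, \<open>b\<close> initial row groups of average height \<open>H\<close>.\<close>

locale alt_partition =
  fixes N :: nat and m :: int and od :: bool and th :: "nat \<Rightarrow> real" and P :: algorithm
  assumes adm: "admissible N m od" and angles: "gauss_legendre_angles N th"
    and min_size: "2 \<le> min_size P"
begin

definition n where "n = num_cols N m od"
definition b where "b = num_groups N m od"
definition H where "H = real N / real b"

definition row_groups :: "range set" where
  "row_groups = (\<lambda>g. (g * N div b, (g + 1) * N div b)) ` {..<b}"

text \<open>The blocks of level \<open>l\<close> which intersect the turning point curve.\<close>

definition crossing :: "nat \<Rightarrow> block set" where
  "crossing l = {B \<in> blocks_at th N m od l. crosses th N m od B}"

lemma n_bounds: "1 \<le> n" "n \<le> N" "1 \<le> N"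
  using adm num_cols_le[of N m od] by (auto simp: n_def admissible_def)

lemma b_bounds:
  shows "1 \<le> b" "b \<le> N" "\<bar>real b - real N / real n\<bar> \<le> 1 / 2"
proof -
  have q: "1 \<le> real N / real n" "real N / real n \<le> real N"
    using n_bounds by (auto simp: divide_le_eq)
  have r: "1 \<le> round (real N / real n)" using q(1) round_mono[of 1] by simp
  then have rb: "real b = of_int (round (real N / real n))"
    unfolding b_def num_groups_def n_def by simp
  show "1 \<le> b" using r unfolding b_def num_groups_def n_def by simp
  have "round (real N / real n) \<le> int N" using round_mono[OF q(2)] by simp
  then show "b \<le> N" unfolding b_def num_groups_def n_def by simp
  show "\<bar>real b - real N / real n\<bar> \<le> 1 / 2" using of_int_round_abs_le rb by metis
qed

lemma group_size:
  shows "1 \<le> H" "H \<le> 2 * real n" "real n \<le> 3 / 2 * H" "H \<le> real N" "real b * H = real N"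
proof -
  have b0: "0 < real b" and n0: "0 < real n" using b_bounds n_bounds by simp_all
  have q: "1 \<le> real N / real n" using n_bounds by simp
  have 1: "real N / real n \<le> 2 * real b" "real b \<le> 3 / 2 * (real N / real n)"
    using b_bounds(1,3) q by linarith+
  then have 2: "real N \<le> 2 * real b * real n" "real b * real n \<le> 3 / 2 * real N"
    using n0 by (simp_all add: field_simps)
  show "H \<le> 2 * real n" "real n \<le> 3 / 2 * H" using 2 b0 by (simp_all add: H_def field_simps)
  show "1 \<le> H" "H \<le> real N" "real b * H = real N" using b_bounds(1,2) n_bounds
    by (simp_all add: H_def field_simps)
qed

lemma row_groups_length: "R \<in> row_groups \<Longrightarrow> \<bar>real (card (indices R)) - H\<bar> < 1"
proof -
  assume "R \<in> row_groups"
  then obtain g where R: "R = (g * N div b, (g + 1) * N div b)" by (auto simp: row_groups_def)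
  have fl: "real (x div b) \<le> real x / real b" "real x / real b < real (x div b) + 1" for x
    using floor_correct[of "real x / real b"] floor_divide_of_nat_eq[of x b, where 'a = real] by simp_all
  have "real ((g + 1) * N) / real b = real (g * N) / real b + H"
    by (simp add: H_def add_divide_distrib algebra_simps)
  moreover have "g * N div b \<le> (g + 1) * N div b" by (intro div_le_mono) simp
  ultimately show ?thesis
    using fl[of "g * N"] fl[of "(g + 1) * N"] by (simp add: R card_indices of_nat_diff)
qed

lemma row_groups_nonempty: "R \<in> row_groups \<Longrightarrow> indices R \<noteq> {}"
proof -
  assume "R \<in> row_groups"
  then obtain g where R: "R = (g * N div b, (g + 1) * N div b)" by (auto simp: row_groups_def)
  have "(g * N + b) div b \<le> (g + 1) * N div b" using b_bounds by (intro div_le_mono) simp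
  then show ?thesis using b_bounds by (simp add: R indices_nonempty_iff)
qed

lemma row_groups_subset: "R \<in> row_groups \<Longrightarrow> indices R \<subseteq> {..<N}"
proof -
  assume "R \<in> row_groups"
  then obtain g where R: "R = (g * N div b, (g + 1) * N div b)" and g: "g < b"
    by (auto simp: row_groups_def)
  have "(g + 1) * N \<le> b * N" using g by (intro mult_right_mono) auto
  then have "(g + 1) * N div b \<le> b * N div b" by (intro div_le_mono)
  then show ?thesis using b_bounds by (auto simp: R indices_def)
qed

lemma row_groups_separated: "separated row_groups"
proof -
  have *: "(g + 1) * N div b \<le> g' * N div b" if "g < g'" for g g'
    using that by (intro div_le_mono mult_right_mono) auto
  show ?thesis unfolding separated_def row_groups_def
  proof (intro ballI impI; elim imageE)
    fix R R' g g' assume ne: "R \<noteq> R'" and R: "R = (g * N div b, (g + 1) * N div b)"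
      "R' = (g' * N div b, (g' + 1) * N div b)"
    then have "g < g' \<or> g' < g" by (metis linorder_neqE_nat)
    then show "snd R \<le> fst R' \<or> snd R' \<le> fst R" using *[of g g'] *[of g' g] by (auto simp: R)
  qed
qed

lemma card_row_groups: "finite row_groups" "card row_groups \<le> b"
  unfolding row_groups_def using card_image_le[of "{..<b}"] by auto

lemma initial_blocks_eq: "initial_blocks N m od = row_groups \<times> {(0, n)}"
  unfolding initial_blocks_def row_groups_def Let_def b_def n_def by auto

text \<open>The nonempty row and column ranges after \<open>l\<close> bisections. Crossing blocks of level \<open>l\<close> have been
  split exactly \<open>l\<close> times, whereas other blocks may have been split less often.\<close>

definition rows_at where "rows_at l = split_level row_groups l"
definition cols_at where "cols_at l = split_level {(0, n)} l"

lemma rows_at_props: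
  assumes "R \<in> rows_at l"
  shows "indices R \<subseteq> {..<N}" "\<bar>real (card (indices R)) - H / 2 ^ l\<bar> < 1" "1 \<le> card (indices R)"
  using split_level_subset[OF row_groups_subset assms[unfolded rows_at_def]]
    split_level_length[OF row_groups_length assms[unfolded rows_at_def]]
    split_level_nonempty[OF assms[unfolded rows_at_def]]
  by (auto simp: card_indices)

lemma cols_at_props:
  assumes "R \<in> cols_at l"
  shows "indices R \<subseteq> {..<n}" "\<bar>real (card (indices R)) - real n / 2 ^ l\<bar> < 1"
    "1 \<le> card (indices R)"
proof -
  note R = assms[unfolded cols_at_def]
  have "indices (0, n) \<subseteq> {..<n}" by (auto simp: indices_def)
  then show "indices R \<subseteq> {..<n}" by (intro split_level_subset[OF _ R]) auto
  have "\<bar>real (card (indices (0, n))) - real n\<bar> < 1" by (simp add: card_indices)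
  then show "\<bar>real (card (indices R)) - real n / 2 ^ l\<bar> < 1" by (intro split_level_length[OF _ R]) auto
  show "1 \<le> card (indices R)" using split_level_nonempty[OF R] by (simp add: card_indices)
qed

lemma quarters_subset:
  assumes "B \<in> rows_at l \<times> cols_at l"
  shows "quarters B \<subseteq> rows_at (Suc l) \<times> cols_at (Suc l)"
  using assms unfolding rows_at_def cols_at_def quarters_def
  by (auto simp: cells_nonempty_iff)

lemma crossing_subset: "crossing l \<subseteq> rows_at l \<times> cols_at l"
proof (induction l)
  case 0
  have "initial_blocks N m od \<subseteq> rows_at 0 \<times> cols_at 0"
    using row_groups_nonempty n_bounds
    by (auto simp: initial_blocks_eq rows_at_def cols_at_def indices_nonempty_iff)
  then show ?case by (auto simp: crossing_def)
next
  case (Suc l)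
  show ?case
  proof
    fix B assume B: "B \<in> crossing (Suc l)"
    then obtain A where A: "A \<in> blocks_at th N m od l"
      "B \<in> (if crosses th N m od A then quarters A else {A})"
      unfolding crossing_def blocks_at.simps by blast
    have "crosses th N m od A" using A(2) B by (auto simp: crossing_def split: if_splits)
    then have "A \<in> rows_at l \<times> cols_at l" "B \<in> quarters A"
      using A Suc by (auto simp: crossing_def)
    then show "B \<in> rows_at (Suc l) \<times> cols_at (Suc l)" using quarters_subset by blast
  qed
qed

lemma blocks_at_subset: "blocks_at th N m od l \<subseteq> (\<Union>s\<le>l. rows_at s \<times> cols_at s)"
proof (induction l)
  case 0
  show ?case
    using row_groups_nonempty n_bounds
    by (auto simp: initial_blocks_eq rows_at_def cols_at_def indices_nonempty_iff)
next
  case (Suc l)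
  show ?case
  proof
    fix B assume "B \<in> blocks_at th N m od (Suc l)"
    then obtain A where A: "A \<in> blocks_at th N m od l"
      "B \<in> (if crosses th N m od A then quarters A else {A})"
      unfolding blocks_at.simps by blast
    show "B \<in> (\<Union>s\<le>Suc l. rows_at s \<times> cols_at s)"
    proof (cases "crosses th N m od A")
      case True
      then have "A \<in> rows_at l \<times> cols_at l" using A crossing_subset by (auto simp: crossing_def)
      then show ?thesis using True A(2) quarters_subset by fastforce
    next
      case False
      then have "B \<in> (\<Union>s\<le>l. rows_at s \<times> cols_at s)" using A Suc by auto
      then show ?thesis by (force simp: le_Suc_eq)
    qed
  qed
qed

lemma finite_blocks_at: "finite (blocks_at th N m od l)"
proof -
  have "finite (rows_at s \<times> cols_at s)" for s
    using card_row_groups by (simp add: rows_at_def cols_at_def finite_split_level)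
  then show ?thesis using blocks_at_subset finite_subset by (metis (no_types, lifting) finite_UN finite_atMost)
qed

lemma finite_crossing: "finite (crossing l)"
  using finite_blocks_at by (simp add: crossing_def)

text \<open>The factor \<open>5\<close> absorbs the rounding errors: the real sides \<open>H / 2 ^ s\<close> and \<open>n / 2 ^ s\<close> differ by
  a factor of at most two, the integer sides differ from them by less than one and are at least one.\<close>

lemma block_props:
  assumes "B \<in> blocks_at th N m od l"
  shows "indices (fst B) \<subseteq> {..<N}" "indices (snd B) \<subseteq> {..<n}" "1 \<le> height B" "1 \<le> width B"
    "height B \<le> N" "width B \<le> N" "height B \<le> 5 * width B" "width B \<le> 5 * height B"
proof -
  have "B \<in> (\<Union>s\<le>l. rows_at s \<times> cols_at s)" using blocks_at_subset assms by (rule subsetD)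
  then obtain s where s: "fst B \<in> rows_at s" "snd B \<in> cols_at s" by auto
  note r = rows_at_props[OF s(1), folded height_def] and c = cols_at_props[OF s(2), folded width_def]
  show sub: "indices (fst B) \<subseteq> {..<N}" "indices (snd B) \<subseteq> {..<n}" and pos: "1 \<le> height B" "1 \<le> width B"
    using r(1,3) c(1,3) by auto
  show "height B \<le> N" "width B \<le> N"
    using card_mono[OF _ sub(1)] card_mono[OF _ sub(2)] n_bounds by (auto simp: height_def width_def)
  have "H / 2 ^ s \<le> 2 * (real n / 2 ^ s)" "real n / 2 ^ s \<le> 3 / 2 * (H / 2 ^ s)"
    using group_size by (auto simp: field_simps)
  moreover have "1 \<le> real (height B)" "1 \<le> real (width B)" using pos by simp_all
  ultimately have "real (height B) \<le> 5 * real (width B)" "real (width B) \<le> 5 * real (height B)"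
    using r(2) c(2) by (linarith+)
  then show "height B \<le> 5 * width B" "width B \<le> 5 * height B" by linarith+
qed

lemma ranges_less:
  assumes "separated S" "R \<in> S" "R' \<in> S" "fst R < fst R'" "i \<in> indices R" "i' \<in> indices R'"
  shows "i < i'"
proof -
  have "snd R \<le> fst R' \<or> snd R' \<le> fst R" using assms by (auto simp: separated_def)
  then show ?thesis using assms by (auto simp: indices_def)
qed

lemma inj_on_fst_split_level: "separated S \<Longrightarrow> inj_on (\<lambda>R. int (fst R)) (split_level S l)"
proof (rule inj_onI)
  fix R R' assume sep: "separated S" and R: "R \<in> split_level S l" "R' \<in> split_level S l"
    and eq: "int (fst R) = int (fst R')"
  have "fst R < snd R" "fst R' < snd R'" using R split_level_nonempty by blast+
  then show "R = R'" using separated_split_level[OF sep, of l] R eq unfolding separated_def by force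
qed

text \<open>Along the curve the angle decreases as the degree grows, so no crossing block lies strictly
  before another one in both coordinates, where the rows are read in order of increasing angle.\<close>

lemma card_crossing_le: "card (crossing l) \<le> (b + 1) * 2 ^ l"
proof -
  have sR: "separated (rows_at l)" and sC: "separated (cols_at l)"
    unfolding rows_at_def cols_at_def
    by (rule separated_split_level[OF row_groups_separated])
       (rule separated_split_level, simp add: separated_def)
  \<comment> \<open>The key \<open>f\<close> lists the row ranges by increasing angle, for either order of the angles.\<close>
  obtain f :: "range \<Rightarrow> int" where inj: "inj_on f (rows_at l)"
    and f: "\<And>R R' i i'. R \<in> rows_at l \<Longrightarrow> R' \<in> rows_at l \<Longrightarrow> f R < f R' \<Longrightarrow>
      i \<in> indices R \<Longrightarrow> i' \<in> indices R' \<Longrightarrow> th i < th i'"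
  proof -
    have injf: "inj_on (\<lambda>R. int (fst R)) (rows_at l)"
      unfolding rows_at_def by (rule inj_on_fst_split_level[OF row_groups_separated])
    have N: "i < N" if "i \<in> indices R" "R \<in> rows_at l" for i R using rows_at_props that by blast
    consider "monotone_on {..<N} (<) (<) th" | "monotone_on {..<N} (<) (>) th"
      using angles by (auto simp: gauss_legendre_angles_def)
    then show ?thesis
    proof cases
      case 1
      have "th i < th i'" if "R \<in> rows_at l" "R' \<in> rows_at l" "int (fst R) < int (fst R')"
        "i \<in> indices R" "i' \<in> indices R'" for R R' i i'
        using ranges_less[OF sR that(1,2) _ that(4,5)] that N 1 by (auto simp: monotone_on_def)
      then show ?thesis using that[of "\<lambda>R. int (fst R)"] injf by blast
    next
      case 2
      have "th i < th i'" if "R \<in> rows_at l" "R' \<in> rows_at l" "- int (fst R) < - int (fst R')"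
        "i \<in> indices R" "i' \<in> indices R'" for R R' i i'
        using ranges_less[OF sR that(2,1) _ that(5,4)] that N 2 by (auto simp: monotone_on_def)
      moreover have "inj_on (\<lambda>R. - int (fst R)) (rows_at l)" using injf by (auto simp: inj_on_def)
      ultimately show ?thesis using that[of "\<lambda>R. - int (fst R)"] by blast
    qed
  qed
  have "card (crossing l) \<le> card (rows_at l) + card (cols_at l)"
  proof (rule card_le_no_strict_chain[OF _ _ crossing_subset inj])
    show "finite (rows_at l)" "finite (cols_at l)"
      using card_row_groups by (simp_all add: rows_at_def cols_at_def finite_split_level)
    show "inj_on (\<lambda>C. int (fst C)) (cols_at l)"
      unfolding cols_at_def by (intro inj_on_fst_split_level) (simp add: separated_def)
    fix R C R' C' assume B: "(R, C) \<in> crossing l" "(R', C') \<in> crossing l"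
    show "\<not> (f R < f R' \<and> int (fst C) < int (fst C'))"
    proof
      assume lt: "f R < f R' \<and> int (fst C) < int (fst C')"
      have mem: "R \<in> rows_at l" "R' \<in> rows_at l" "C \<in> cols_at l" "C' \<in> cols_at l"
        using B crossing_subset by auto
      let ?t = "\<lambda>j. turning_point (degrees N m od ! j) m"
      obtain i j where ij: "i \<in> indices R" "j \<in> indices C" "\<not> nonosc_entry th N m od i j"
        using B(1) by (auto simp: crossing_def crosses_def nonosc_block_def)
      obtain i' j' where ij': "i' \<in> indices R'" "j' \<in> indices C'" "\<not> osc_entry th N m od i' j'"
        using B(2) by (auto simp: crossing_def crosses_def osc_block_def)
      \<comment> \<open>The first block has an entry on or above the curve, the second one an entry on or below it.\<close>
      have m0: "m \<noteq> 0" and 1: "th i' \<le> ?t j'" using ij' by (auto simp: osc_entry_def)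
      have 2: "?t j \<le> th i" using ij m0 by (auto simp: nonosc_entry_def)
      have "j < j'" using ranges_less[OF sC mem(3,4) _ ij(2) ij'(2)] lt by simp
      moreover have "j' < num_cols N m od" using cols_at_props(1)[OF mem(4)] ij' by (auto simp: n_def)
      ultimately have 3: "?t j' \<le> ?t j"
        using m0 by (intro turning_point_antimono degrees_mono degrees_ge) auto
      have "th i < th i'" using f[OF mem(1,2)] lt ij ij' by blast
      then show False using 1 2 3 by linarith
    qed
  qed
  also have "\<dots> \<le> 2 ^ l * b + 2 ^ l * 1"
    unfolding rows_at_def cols_at_def
    using card_split_level_le[OF card_row_groups(1), of l] card_row_groups(2)
      card_split_level_le[of "{(0, n)}" l]
    by (intro add_mono) (auto intro: order_trans)
  finally show ?thesis by (simp add: algebra_simps)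
qed

text \<open>A crossing block with at least two rows occurs only at levels at which the average height
  still exceeds one. This bounds the number of levels and the effect of rounding.\<close>

lemma crossing_level_less:
  assumes "B \<in> crossing l" "2 \<le> height B"
  shows "2 ^ l < H"
proof -
  have "fst B \<in> rows_at l" using assms crossing_subset by (metis mem_Times_iff subsetD)
  then have "\<bar>real (height B) - H / 2 ^ l\<bar> < 1" using rows_at_props(2) by (simp add: height_def)
  moreover have "2 \<le> real (height B)" using assms(2) by simp
  ultimately have "1 < H / 2 ^ l" by linarith
  then show ?thesis by (simp add: field_simps)
qed

lemma final_crossing_small:
  assumes "B \<in> final_blocks P th N m od" "crosses th N m od B"
  shows "height B < min_size P \<or> width B < min_size P"
proof -
  let ?Q = "\<lambda>l. \<forall>B\<in>blocks_at th N m od l.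
     crosses th N m od B \<longrightarrow> height B < min_size P \<or> width B < min_size P"
  \<comment> \<open>The stopping criterion holds at level \<open>N\<close>, so that the least such level exists.\<close>
  have "?Q N"
  proof (intro ballI impI)
    fix B assume B: "B \<in> blocks_at th N m od N" "crosses th N m od B"
    have "H < 2 ^ N" using group_size(4) of_nat_less_two_power[of N] by (rule order_le_less_trans)
    then have "\<not> 2 \<le> height B" using crossing_level_less[of B N] B by (auto simp: crossing_def)
    then show "height B < min_size P \<or> width B < min_size P" using min_size by linarith
  qed
  then have "?Q (num_levels P th N m od)" unfolding num_levels_def by (rule LeastI)
  then show ?thesis using assms by (auto simp: final_blocks_def)
qed

lemma level_less:
  assumes "l < num_levels P th N m od"
  shows "2 ^ l < H"
proof -
  obtain B where "B \<in> blocks_at th N m od l" "crosses th N m od B" "min_size P \<le> height B"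
    using not_less_Least[OF assms[unfolded num_levels_def]] by (auto simp: not_less)
  then show ?thesis using crossing_level_less[of B l] min_size by (auto simp: crossing_def)
qed

lemma num_levels_le:
  assumes "2 \<le> N"
  shows "real (num_levels P th N m od) \<le> 3 * ln (real N)"
proof -
  have ln2: "2 / 3 \<le> ln (2::real)" using ln2_ge_two_thirds .
  have lnN: "ln 2 \<le> ln (real N)" using assms by simp
  show ?thesis
  proof (cases "num_levels P th N m od")
    case 0
    then show ?thesis using ln2 lnN by simp
  next
    case (Suc l)
    have "2 ^ l < real N" using level_less[of l] Suc group_size(4) by linarith
    then have "ln (2 ^ l) \<le> ln (real N)" using assms by (subst ln_le_cancel_iff) auto
    then have "real l * ln 2 \<le> ln (real N)" by (simp add: ln_realpow)
    moreover have "real l * (2 / 3) \<le> real l * ln 2" using ln2 by (intro mult_left_mono) auto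
    ultimately show ?thesis using Suc ln2 lnN by simp
  qed
qed

lemma sum_weight_crossing_le:
  assumes "2 ^ l < H"
  shows "real (sum weight (crossing l)) \<le> 9 * real N"
proof -
  have w: "real (weight B) \<le> H / 2 ^ l + real n / 2 ^ l + 2" if "B \<in> crossing l" for B
  proof -
    have B: "fst B \<in> rows_at l" "snd B \<in> cols_at l"
      using that crossing_subset by (metis mem_Times_iff subsetD)+
    show ?thesis using rows_at_props(2)[OF B(1)] cols_at_props(2)[OF B(2)]
      unfolding weight_def height_def width_def of_nat_add by linarith
  qed
  have b1: "1 \<le> real b" using b_bounds by simp
  have "real (sum weight (crossing l)) \<le> real (card (crossing l)) * (H / 2 ^ l + real n / 2 ^ l + 2)"
    using sum_bounded_above[of "crossing l" "\<lambda>B. real (weight B)"] w by simp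
  also have "\<dots> \<le> real ((b + 1) * 2 ^ l) * (H / 2 ^ l + real n / 2 ^ l + 2)"
    using group_size(1) by (intro mult_right_mono of_nat_mono card_crossing_le) auto
  also have "\<dots> = (real b + 1) * (H + real n + 2 * 2 ^ l)"
    by (simp add: field_simps)
  also have "\<dots> \<le> (2 * real b) * (H + 3 / 2 * H + 2 * H)"
    using b1 assms group_size by (intro mult_mono) auto
  also have "\<dots> = 9 * (real b * H)" by simp
  also have "\<dots> = 9 * real N" by (simp add: group_size(5))
  finally show ?thesis .
qed

lemma sum_weight_initial_le: "real (sum weight (blocks_at th N m od 0)) \<le> 4 * real N"
proof -
  have w: "real (weight B) \<le> H + 1 + real n" if "B \<in> initial_blocks N m od" for B
    using that row_groups_length[of "fst B"]
    by (auto simp: initial_blocks_eq weight_def height_def width_def card_indices)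
  have "card (initial_blocks N m od) \<le> b"
    using card_row_groups by (simp add: initial_blocks_eq card_cartesian_product)
  then have "real (card (initial_blocks N m od)) * (H + 1 + real n) \<le> real b * (H + H + 3 / 2 * H)"
    using group_size by (intro mult_mono) auto
  moreover have "real (sum weight (initial_blocks N m od))
      \<le> real (card (initial_blocks N m od)) * (H + 1 + real n)"
    using sum_bounded_above[of "initial_blocks N m od" "\<lambda>B. real (weight B)"] w by simp
  ultimately show ?thesis using group_size(5) by simp
qed

text \<open>Every block of a level is a block of the previous level or a quarter of one of its crossing
  blocks.\<close>

lemma sum_weight_upto_le:
  assumes "k \<le> num_levels P th N m od"
  shows "real (sum weight (\<Union>l\<le>k. blocks_at th N m od l)) \<le> (4 + 18 * real k) * real N"
  using assms
proof (induction k)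
  case 0
  show ?case using sum_weight_initial_le by simp
next
  case (Suc k)
  let ?A = "\<Union>l\<le>k. blocks_at th N m od l" and ?Q = "\<Union>B\<in>crossing k. quarters B"
  have finA: "finite ?A" and finQ: "finite ?Q"
    using finite_blocks_at finite_crossing finite_quarters by auto
  have "blocks_at th N m od (Suc k) \<subseteq> ?A \<union> ?Q"
    by (fastforce simp: crossing_def split: if_splits)
  then have "(\<Union>l\<le>Suc k. blocks_at th N m od l) \<subseteq> ?A \<union> ?Q"
    by (auto simp only: atMost_Suc UN_insert Un_iff subset_iff)
  then have "sum weight (\<Union>l\<le>Suc k. blocks_at th N m od l) \<le> sum weight (?A \<union> ?Q)"
    using finA finQ by (intro sum_mono2) auto
  also have "\<dots> \<le> sum weight ?A + sum weight ?Q" using finA finQ by (simp add: sum_Un_nat)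
  also have "sum weight ?Q \<le> (\<Sum>B\<in>crossing k. sum weight (quarters B))"
    by (rule sum_Union_le[OF finite_crossing finite_quarters])
  also have "\<dots> \<le> (\<Sum>B\<in>crossing k. 2 * weight B)" by (intro sum_mono sum_weight_quarters_le)
  finally have "sum weight (\<Union>l\<le>Suc k. blocks_at th N m od l)
      \<le> sum weight ?A + 2 * sum weight (crossing k)"
    by (simp flip: sum_distrib_left)
  then have "real (sum weight (\<Union>l\<le>Suc k. blocks_at th N m od l))
      \<le> real (sum weight ?A) + 2 * real (sum weight (crossing k))" by linarith
  also have "\<dots> \<le> (4 + 18 * real k) * real N + 2 * (9 * real N)"
    using Suc sum_weight_crossing_le level_less by (intro add_mono mult_left_mono) auto
  finally show ?case by (simp add: algebra_simps)
qed

lemma sum_weight_examined_le: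
  assumes "2 \<le> N"
  shows "real (sum weight (examined_blocks P th N m od)) \<le> 60 * real N * ln (real N)"
proof -
  have "2 / 3 \<le> ln (real N)" using ln2_ge_two_thirds assms ln_le_cancel_iff[of 2 "real N"] by linarith
  then have "4 + 18 * real (num_levels P th N m od) \<le> 60 * ln (real N)"
    using num_levels_le[OF assms] by linarith
  then have "(4 + 18 * real (num_levels P th N m od)) * real N \<le> 60 * ln (real N) * real N"
    by (intro mult_right_mono) auto
  then show ?thesis using sum_weight_upto_le[OF order_refl]
    unfolding examined_blocks_def by (simp add: mult_ac)
qed

lemma finite_examined: "finite (examined_blocks P th N m od)"
  using finite_blocks_at by (simp add: examined_blocks_def)

lemma final_subset_examined: "final_blocks P th N m od \<subseteq> examined_blocks P th N m od"
  by (auto simp: final_blocks_def examined_blocks_def)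

lemma sum_weight_final_le:
  assumes "2 \<le> N"
  shows "real (sum weight (final_blocks P th N m od)) \<le> 60 * real N * ln (real N)"
proof -
  have "sum weight (final_blocks P th N m od) \<le> sum weight (examined_blocks P th N m od)"
    using finite_examined final_subset_examined by (intro sum_mono2) auto
  then show ?thesis using sum_weight_examined_le[OF assms] by linarith
qed

end

section \<open>Rank bounds of the blocks\<close>

lemma dim_row_block_mat_le: "dim_row (block_mat A B) \<le> dim_row A"
  and dim_col_block_mat_le: "dim_col (block_mat A B) \<le> dim_col A"
  using card_mono[of "{..<dim_row A}" "{i. i < dim_row A \<and> i \<in> indices (fst B)}"]
    card_mono[of "{..<dim_col A}" "{i. i < dim_col A \<and> i \<in> indices (snd B)}"]
  by (auto simp: block_mat_def dim_submatrix)

lemma dim_block_mat: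
  assumes "subblock_of A B"
  shows "dim_row (block_mat A B) = height B" "dim_col (block_mat A B) = width B"
proof -
  have "{i. i < dim_row A \<and> i \<in> indices (fst B)} = indices (fst B)"
    "{i. i < dim_col A \<and> i \<in> indices (snd B)} = indices (snd B)"
    using assms by (auto simp: subblock_of_def)
  then show "dim_row (block_mat A B) = height B" "dim_col (block_mat A B) = width B"
    by (simp_all add: block_mat_def dim_submatrix height_def width_def)
qed

lemma numerical_rank_block_mat_le:
  "0 \<le> \<epsilon> \<Longrightarrow> numerical_rank \<epsilon> (block_mat A B) \<le> numerical_rank \<epsilon> A"
  unfolding block_mat_def by (rule numerical_rank_submatrix_le)

lemma dim_alt_mat: "dim_row (alt_mat th N m od) = N" "dim_col (alt_mat th N m od) = num_cols N m od"
  by (simp_all add: alt_mat_def)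

lemma block_ranks_subset:
  assumes "0 \<le> \<epsilon>"
  shows "block_ranks \<epsilon> P th N m od \<subseteq> {..N}"
proof -
  have "numerical_rank \<epsilon> (block_mat (alt_mat th N m od) B) \<le> N" for B
    using numerical_rank_le_dim_col[OF assms, of "block_mat (alt_mat th N m od) B"]
      dim_col_block_mat_le[of "alt_mat th N m od" B] num_cols_le[of N m od]
    by (simp add: dim_alt_mat)
  moreover have "numerical_rank \<epsilon> (block_mat (block_mat (alt_mat th N m od) B) B') \<le> N" for B B'
    using numerical_rank_block_mat_le[OF assms] calculation by (rule order_trans)
  ultimately show ?thesis by (auto simp: block_ranks_def relevant_subblocks_def)
qed

lemma block_ranks_le_matrix_rank_bound:
  assumes "0 \<le> \<epsilon>" "k \<in> block_ranks \<epsilon> P th N m od"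
  shows "k \<le> matrix_rank_bound \<epsilon> P th N m od"
  unfolding matrix_rank_bound_def
  using assms(2) bdd_above_mono[OF bdd_above_Iic block_ranks_subset[OF assms(1)]] by (rule cSup_upper)

lemma block_ranks_le_rank_bound:
  assumes "0 \<le> \<epsilon>" "admissible N m od" "k \<in> block_ranks \<epsilon> P th N m od"
  shows "k \<le> rank_bound \<epsilon> P th N"
  unfolding rank_bound_def
proof (rule cSup_upper)
  show "k \<in> (\<Union>(m, od)\<in>{(m, od). admissible N m od}. block_ranks \<epsilon> P th N m od)"
    using assms by blast
  have "(\<Union>(m, od)\<in>{(m, od). admissible N m od}. block_ranks \<epsilon> P th N m od) \<subseteq> {..N}"
    using block_ranks_subset[OF assms(1)] by blast
  then show "bdd_above (\<Union>(m, od)\<in>{(m, od). admissible N m od}. block_ranks \<epsilon> P th N m od)"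
    by (rule bdd_above_mono[OF bdd_above_Iic])
qed

lemma matrix_rank_bound_le_rank_bound:
  assumes "0 \<le> \<epsilon>" "admissible N m od"
  shows "matrix_rank_bound \<epsilon> P th N m od \<le> rank_bound \<epsilon> P th N"
proof (cases "block_ranks \<epsilon> P th N m od = {}")
  case True
  then show ?thesis by (simp add: matrix_rank_bound_def)
next
  case False
  then show ?thesis unfolding matrix_rank_bound_def
    by (intro cSup_least block_ranks_le_rank_bound[OF assms])
qed

section \<open>A subblock of positive numerical rank\<close>

lemma norm_assoc_legendre_0_0: "norm_assoc_legendre 0 0 x = 1 / sqrt 2"
proof -
  have "assoc_legendre 0 0 t = 1" for t by (simp add: assoc_legendre_def legendre_poly_def)
  then show ?thesis by (simp add: norm_assoc_legendre_def)
qed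

lemma num_cols_0_even: "num_cols N 0 False = N"
  using length_filter_parity[of 0 False "2 * N"] by (simp add: num_cols_def degrees_def)

text \<open>Every level of the tree of a nonempty range contains a nonempty range starting with the first index.\<close>

lemma tree_level_first: "0 < q \<Longrightarrow> \<exists>e>0. (0, e) \<in> tree_level (0, q) l"
proof (induction l)
  case (Suc l)
  then obtain e where e: "0 < e" "(0, e) \<in> tree_level (0, q) l" by blast
  have "(0, e div 2) \<in> tree_level (0, q) (Suc l)" "(e div 2, e) \<in> tree_level (0, q) (Suc l)"
    using e(2) by (auto simp: halves_def intro!: bexI[of _ "(0, e)"])
  then show ?case using e(1) by (cases "e div 2 = 0") auto
qed auto

lemma submatrix_first_column:
  assumes "i < dim_row A" "0 < e" "0 < dim_col A"
  shows "block_mat A ((0, dim_row A), (0, e)) $$ (i, 0) = A $$ (i, 0)"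
proof -
  have "{a \<in> {0..<dim_row A}. a < i} = {..<i}" using assms by auto
  moreover have "{a \<in> {0..<e}. a < 0} = {}" by auto
  ultimately show ?thesis
    using submatrix_index_card[of i A 0 "{0..<dim_row A}" "{0..<e}"] assms
    by (simp add: block_mat_def indices_def)
qed

text \<open>For \<open>m = 0\<close> the even matrix is square and entirely oscillatory, hence its own only final block.
  Its first column is constant.\<close>

lemma rank_bound_pos:
  assumes \<epsilon>: "0 < \<epsilon>" and N: "2 * \<epsilon>\<^sup>2 < real N"
  shows "1 \<le> rank_bound \<epsilon> P th N"
proof -
  have N0: "0 < N" using N by (metis of_nat_0_less_iff order_le_less_trans zero_le_mult_iff zero_le_numeral zero_le_power2)
  define A where "A = alt_mat th N 0 False"
  have dA: "dim_row A = N" "dim_col A = N" by (simp_all add: A_def dim_alt_mat num_cols_0_even)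
  let ?B = "((0, N), (0, N)) :: block"
  have adm: "admissible N 0 False" using N0 by (simp add: admissible_def num_cols_0_even)
  have osc: "osc_block th N 0 False B" for B by (simp add: osc_block_def osc_entry_def)
  have "initial_blocks N 0 False = {?B}"
    using N0 by (simp add: initial_blocks_def num_groups_def num_cols_0_even)
  then have "blocks_at th N 0 False l = {?B}" for l
    using osc by (induction l) (auto simp: crosses_def)
  then have fin: "?B \<in> final_blocks P th N 0 False" by (simp add: final_blocks_def)
  define K where "K = block_mat A ?B"
  have dK: "dim_row K = N" "dim_col K = N"
    using dim_block_mat[of A ?B] dA
    by (simp_all add: K_def subblock_of_def indices_def height_def width_def atLeast0LessThan)
  obtain e where e: "0 < e" "(0, e) \<in> tree_level (0, N) (depth P (mat_size K))"
    using tree_level_first[OF N0] by blast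
  define S where "S = block_mat K ((0, N), (0, e))"
  have "S \<in> relevant_subblocks (depth P) K"
    unfolding relevant_subblocks_def mem_Collect_eq
    by (rule exI[of _ "(0, N)"], rule exI[of _ "(0, e)"], rule exI[of _ 0]) (use e dK in \<open>simp add: S_def\<close>)
  then have "numerical_rank \<epsilon> S \<in> block_ranks \<epsilon> P th N 0 False"
    using fin osc unfolding block_ranks_def K_def A_def by blast
  then have le: "numerical_rank \<epsilon> S \<le> rank_bound \<epsilon> P th N"
    using \<epsilon> adm by (intro block_ranks_le_rank_bound) auto
  have "degrees N 0 False ! 0 = 0"
    using N0 by (simp add: degrees_def upt_conv_Cons)
  then have A0: "A $$ (i, 0) = complex_of_real (1 / sqrt 2)" if "i < N" for i
    using that N0 by (simp add: A_def alt_mat_def num_cols_0_even norm_assoc_legendre_0_0)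
  have K0: "K $$ (i, 0) = A $$ (i, 0)" if "i < N" for i
    using submatrix_first_column[of i A N] dA N0 that by (simp add: K_def)
  have S0: "S $$ (i, 0) = complex_of_real (1 / sqrt 2)" if "i < N" for i
    using submatrix_first_column[of i K e] dK N0 that e K0 A0 by (simp add: S_def)
  have dS: "dim_row S = N"
    unfolding S_def block_mat_def dim_submatrix indices_def using dK by (simp add: set_eq_iff lessThan_def[symmetric])
  have "0 \<in> {j. j < dim_col K \<and> j \<in> indices (0, e)}" using N0 e dK by (simp add: indices_def)
  then have cS: "0 < dim_col S"
    unfolding S_def block_mat_def dim_submatrix by (auto simp: card_gt_0_iff)
  have "(\<Sum>i<dim_row S. (cmod (S $$ (i, 0)))\<^sup>2) = (\<Sum>i<N. 1 / 2)"
    unfolding dS using S0 by (intro sum.cong refl) (simp add: norm_divide power_divide)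
  then have "\<epsilon>\<^sup>2 < (\<Sum>i<dim_row S. (cmod (S $$ (i, 0)))\<^sup>2)" using N by simp
  then have "1 \<le> numerical_rank \<epsilon> S" using \<epsilon> cS by (intro numerical_rank_pos) auto
  then show ?thesis using le by linarith
qed

section \<open>Cost of the algorithm\<close>

context alt_partition begin

lemma final_block_props:
  assumes "B \<in> final_blocks P th N m od"
  defines "K \<equiv> block_mat (alt_mat th N m od) B"
  shows "dim_row K = height B" "dim_col K = width B" "1 \<le> height B" "1 \<le> width B"
    "height B \<le> N" "width B \<le> N" "height B \<le> 5 * width B" "width B \<le> 5 * height B"
proof -
  have B: "B \<in> blocks_at th N m od (num_levels P th N m od)" using assms by (simp add: final_blocks_def)
  then have "subblock_of (alt_mat th N m od) B"
    using block_props(1,2) by (simp add: subblock_of_def dim_alt_mat n_def)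
  then show "dim_row K = height B" "dim_col K = width B" unfolding K_def by (rule dim_block_mat)+
qed (use block_props[of B "num_levels P th N m od"] assms in \<open>simp_all add: final_blocks_def\<close>)

lemma total_cost_le:
  assumes N: "2 \<le> N" and M: "0 \<le> M"
    and osc: "\<And>B. B \<in> final_blocks P th N m od \<Longrightarrow> osc_block th N m od B \<Longrightarrow>
      real (f (block_mat (alt_mat th N m od) B)) \<le> M * real (weight B)"
    and nonosc: "\<And>B K. B \<in> final_blocks P th N m od \<Longrightarrow> nonosc_block th N m od B \<Longrightarrow>
      K = block_mat (alt_mat th N m od) B \<Longrightarrow> cells (trim P K) \<noteq> {} \<Longrightarrow>
      real (g (block_mat K (trim P K))) \<le> M * real (weight B)"
    and cross: "\<And>B K. B \<in> final_blocks P th N m od \<Longrightarrow> crosses th N m od B \<Longrightarrow>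
      K = block_mat (alt_mat th N m od) B \<Longrightarrow>
      real (h (block_mat K (reduce P K))) \<le> M * real (weight B)"
  shows "real (total_cost P th N m od f g h) \<le> M * (60 * real N * ln (real N))"
proof -
  have "real (total_cost P th N m od f g h) \<le> (\<Sum>B\<in>final_blocks P th N m od. M * real (weight B))"
    unfolding total_cost_def of_nat_sum
    using osc nonosc cross M by (intro sum_mono) (auto simp: Let_def crosses_def)
  also have "\<dots> = M * real (sum weight (final_blocks P th N m od))" by (simp add: sum_distrib_left)
  also have "\<dots> \<le> M * (60 * real N * ln (real N))"
    using sum_weight_final_le[OF N] M by (rule mult_left_mono)
  finally show ?thesis .
qed

text \<open>A final block on the curve has a side shorter than the minimal size, so that its number of
  entries is bounded by a multiple of its weight.\<close>

lemma crossing_entries_le: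
  assumes B: "B \<in> final_blocks P th N m od" "crosses th N m od B"
  shows "dim_row (block_mat (block_mat (alt_mat th N m od) B) R) *
    dim_col (block_mat (block_mat (alt_mat th N m od) B) R) \<le> min_size P * weight B" (is "?r * ?c \<le> _")
proof -
  note p = final_block_props[OF B(1)]
  have "?r * ?c \<le> height B * width B"
    using dim_row_block_mat_le dim_col_block_mat_le p(1,2) by (metis mult_le_mono)
  also have "\<dots> \<le> min_size P * weight B"
  proof (cases "height B < min_size P")
    case True
    then show ?thesis by (intro mult_le_mono) (auto simp: weight_def)
  next
    case False
    then have "width B < min_size P" using final_crossing_small[OF B] by simp
    then have "width B * height B \<le> min_size P * weight B"
      by (intro mult_le_mono) (auto simp: weight_def)
    then show ?thesis by (simp add: mult.commute)
  qed
  finally show ?thesis .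
qed

text \<open>The constants \<open>C1\<close>, \<open>C2\<close> and \<open>C3\<close> are those of the butterfly factorization, of the low-rank
  factorization and of the bookkeeping. They do not depend on the matrix, and neither does \<open>C\<close>; its
  factor \<open>150\<close> is \<open>60\<close>, from the total weight, times \<open>5 / 2\<close>, from \<open>1 + ln N \<le> 5 / 2 * ln N\<close>.\<close>

lemma complexity_le:
  fixes C1 C2 :: real and C3 :: nat
  assumes N: "2 \<le> N" and \<epsilon>: "0 < \<epsilon>"
    and idbf: "\<And>K r t. 0 < dim_row K \<Longrightarrow> 0 < dim_col K \<Longrightarrow> dim_row K \<le> 5 * dim_col K \<Longrightarrow>
        dim_col K \<le> 5 * dim_row K \<Longrightarrow> 1 \<le> r \<Longrightarrow>
        (\<And>S. S \<in> relevant_subblocks (depth P) K \<Longrightarrow> numerical_rank \<epsilon> S \<le> r) \<Longrightarrow>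
        t \<in> {build_time (idbf P) (entry_cost P) K, build_mem (idbf P) K,
          apply_time (idbf P) K, apply_mem (idbf P) K} \<Longrightarrow>
        real t \<le> C1 * (real r)\<^sup>2 * real (mat_size K) * (1 + ln (real (mat_size K)))"
    and lowrank: "\<And>K r t. 0 < dim_row K \<Longrightarrow> 0 < dim_col K \<Longrightarrow> 1 \<le> r \<Longrightarrow> numerical_rank \<epsilon> K \<le> r \<Longrightarrow>
        t \<in> {build_time (lowrank P) (entry_cost P) K, build_mem (lowrank P) K,
          apply_time (lowrank P) K, apply_mem (lowrank P) K} \<Longrightarrow>
        real t \<le> C2 * (real r)\<^sup>2 * real (mat_size K)"
    and book: "\<And>B. bookkeeping P N m od B \<le> C3 * (height B + width B)"
    and trim: "\<And>K. subblock_of K (trim P K)"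
  defines "r \<equiv> max 1 (matrix_rank_bound \<epsilon> P th N m od)"
    and "C \<equiv> 150 * (real C3 + 2 * (\<bar>C1\<bar> + \<bar>C2\<bar> + real ((entry_cost P + 2) * min_size P)) + 1)"
  shows "real (time_complexity P th N m od) \<le> C * (real r)\<^sup>2 * real N * (ln (real N))\<^sup>2"
    and "real (memory_complexity P th N m od) \<le> C * (real r)\<^sup>2 * real N * (ln (real N))\<^sup>2"
proof -
  define A where "A = \<bar>C1\<bar> + \<bar>C2\<bar> + real ((entry_cost P + 2) * min_size P)"
  define rho where "rho = (real r)\<^sup>2"
  define lnN where "lnN = ln (real N)"
  define M where "M = A * rho * (1 + lnN)"
  define S where "S = 60 * real N * lnN"
  have rho: "1 \<le> rho" unfolding rho_def r_def by (intro one_le_power) simp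
  have r1: "1 \<le> r" by (simp add: r_def)
  have lnN: "2 / 3 \<le> lnN" unfolding lnN_def
    using ln2_ge_two_thirds N ln_le_cancel_iff[of 2 "real N"] by linarith
  have A: "0 \<le> A" by (simp add: A_def)
  have M0: "0 \<le> M" using A rho lnN by (simp add: M_def)
  have rank_le: "k \<le> r" if "k \<in> block_ranks \<epsilon> P th N m od" for k
    using block_ranks_le_matrix_rank_bound[OF _ that] \<epsilon> by (simp add: r_def)
  \<comment> \<open>\<open>M\<close> bounds the cost per unit of weight for each of the three treatments of a block.\<close>
  have le_M: "x * rho * (1 + lnN) * w \<le> M * w" if "x \<le> A" "0 \<le> w" for x w
    unfolding M_def using that rho lnN by (intro mult_right_mono) auto
  have mat_size_le: "mat_size (block_mat (alt_mat th N m od) B) \<le> weight B"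
    "1 \<le> mat_size (block_mat (alt_mat th N m od) B)"
    "mat_size (block_mat (alt_mat th N m od) B) \<le> N"
    if "B \<in> final_blocks P th N m od" for B
    using final_block_props[OF that] by (auto simp: mat_size_def weight_def)
  have osc: "real t \<le> M * real (weight B)"
    if B: "B \<in> final_blocks P th N m od" "osc_block th N m od B"
      and K: "K = block_mat (alt_mat th N m od) B"
      and t: "t \<in> {build_time (idbf P) (entry_cost P) K, build_mem (idbf P) K,
          apply_time (idbf P) K, apply_mem (idbf P) K}" for B K t
  proof -
    note p = final_block_props[OF B(1), folded K] and s = mat_size_le[OF B(1), folded K]
    have "real t \<le> C1 * rho * real (mat_size K) * (1 + ln (real (mat_size K)))"
      unfolding rho_def
    proof (rule idbf[OF _ _ _ _ r1 _ t])
      fix Q assume "Q \<in> relevant_subblocks (depth P) K"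
      then have "numerical_rank \<epsilon> Q \<in> block_ranks \<epsilon> P th N m od"
        using B unfolding K block_ranks_def by blast
      then show "numerical_rank \<epsilon> Q \<le> r" by (rule rank_le)
    qed (use p in auto)
    also have "\<dots> \<le> \<bar>C1\<bar> * rho * real (weight B) * (1 + lnN)"
      unfolding lnN_def using s rho by (intro mult_mono add_mono) auto
    also have "\<dots> = \<bar>C1\<bar> * rho * (1 + lnN) * real (weight B)" by (simp add: mult_ac)
    also have "\<dots> \<le> M * real (weight B)" by (rule le_M) (auto simp: A_def)
    finally show ?thesis .
  qed
  have nonosc: "real t \<le> M * real (weight B)"
    if B: "B \<in> final_blocks P th N m od" "nonosc_block th N m od B"
      and K: "K = block_mat (alt_mat th N m od) B" and c: "cells (trim P K) \<noteq> {}"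
      and T: "T = block_mat K (trim P K)"
      and t: "t \<in> {build_time (lowrank P) (entry_cost P) T, build_mem (lowrank P) T,
          apply_time (lowrank P) T, apply_mem (lowrank P) T}" for B K T t
  proof -
    note s = mat_size_le[OF B(1), folded K]
    have d: "0 < dim_row T" "0 < dim_col T"
      using dim_block_mat[OF trim, of K] c
      by (auto simp: T height_def width_def cells_nonempty_iff card_gt_0_iff indices_def)
    have sT: "mat_size T \<le> mat_size K"
      unfolding mat_size_def T using dim_row_block_mat_le dim_col_block_mat_le by (metis max.mono)
    have "numerical_rank \<epsilon> K \<in> block_ranks \<epsilon> P th N m od"
      using B unfolding K block_ranks_def by blast
    then have rT: "numerical_rank \<epsilon> T \<le> r"
      using rank_le numerical_rank_block_mat_le[of \<epsilon> K "trim P K"] \<epsilon>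
      unfolding T by (meson less_imp_le order_trans)
    have "real t \<le> C2 * rho * real (mat_size T)"
      unfolding rho_def by (rule lowrank[OF d r1 rT t])
    also have "\<dots> \<le> \<bar>C2\<bar> * rho * real (weight B)"
      using s sT rho by (intro mult_mono) auto
    also have "\<dots> \<le> \<bar>C2\<bar> * rho * real (weight B) * (1 + lnN)"
      using rho lnN mult_left_mono[of 1 "1 + lnN" "\<bar>C2\<bar> * rho * real (weight B)"] by simp
    also have "\<dots> = \<bar>C2\<bar> * rho * (1 + lnN) * real (weight B)" by (simp add: mult_ac)
    also have "\<dots> \<le> M * real (weight B)" by (rule le_M) (auto simp: A_def)
    finally show ?thesis .
  qed
  have cross: "real (x * (dim_row D * dim_col D)) \<le> M * real (weight B)"
    if B: "B \<in> final_blocks P th N m od" "crosses th N m od B"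
      and D: "D = block_mat (block_mat (alt_mat th N m od) B) R" and x: "x \<le> entry_cost P + 2"
    for B D R x
  proof -
    have "x * (dim_row D * dim_col D) \<le> (entry_cost P + 2) * (min_size P * weight B)"
      unfolding D by (rule mult_le_mono[OF x crossing_entries_le[OF B]])
    then have "real (x * (dim_row D * dim_col D)) \<le> real ((entry_cost P + 2) * min_size P * weight B)"
      by (metis mult.assoc of_nat_mono)
    also have "\<dots> \<le> real ((entry_cost P + 2) * min_size P) * (rho * (1 + lnN)) * real (weight B)"
    proof -
      have "1 * 1 \<le> rho * (1 + lnN)" using rho lnN by (intro mult_mono) auto
      then have "real ((entry_cost P + 2) * min_size P) * 1 \<le> real ((entry_cost P + 2) * min_size P) * (rho * (1 + lnN))"
        by (intro mult_left_mono) auto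
      then show ?thesis unfolding of_nat_mult[of _ "weight B"] by (intro mult_right_mono) auto
    qed
    also have "\<dots> = real ((entry_cost P + 2) * min_size P) * rho * (1 + lnN) * real (weight B)"
      by (simp only: mult.assoc)
    also have "\<dots> \<le> M * real (weight B)" by (rule le_M) (auto simp: A_def)
    finally show ?thesis .
  qed
  have cross1: "real (dim_row D * dim_col D) \<le> M * real (weight B)"
    if "B \<in> final_blocks P th N m od" "crosses th N m od B"
      "D = block_mat (block_mat (alt_mat th N m od) B) R" for B D R
    using cross[OF that, of 1] by simp
  have build: "real (total_cost P th N m od (build_time (idbf P) (entry_cost P))
       (build_time (lowrank P) (entry_cost P)) (\<lambda>D. entry_cost P * (dim_row D * dim_col D))) \<le> M * S"
    unfolding S_def lnN_def using osc nonosc cross by (intro total_cost_le[OF N M0]) auto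
  have apply1: "real (total_cost P th N m od (apply_time (idbf P)) (apply_time (lowrank P))
       (\<lambda>D. 2 * (dim_row D * dim_col D))) \<le> M * S"
    unfolding S_def lnN_def using osc nonosc cross[where x = 2] by (intro total_cost_le[OF N M0]) auto
  have build_mem: "real (total_cost P th N m od (build_mem (idbf P)) (build_mem (lowrank P))
       (\<lambda>D. dim_row D * dim_col D)) \<le> M * S"
    unfolding S_def lnN_def using osc nonosc cross1 by (intro total_cost_le[OF N M0]) auto
  have apply_mem: "real (total_cost P th N m od (apply_mem (idbf P)) (apply_mem (lowrank P))
       (\<lambda>D. dim_row D * dim_col D)) \<le> M * S"
    unfolding S_def lnN_def using osc nonosc cross1 by (intro total_cost_le[OF N M0]) auto
  have books: "real (bookkeeping_cost P th N m od) \<le> real C3 * S"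
  proof -
    have "bookkeeping_cost P th N m od \<le> C3 * sum weight (examined_blocks P th N m od)"
      unfolding bookkeeping_cost_def sum_distrib_left weight_def using book by (intro sum_mono)
    then have "real (bookkeeping_cost P th N m od) \<le> real C3 * real (sum weight (examined_blocks P th N m od))"
      by (metis of_nat_le_iff of_nat_mult)
    also have "\<dots> \<le> real C3 * S"
      unfolding S_def lnN_def using sum_weight_examined_le[OF N] by (intro mult_left_mono) auto
    finally show ?thesis .
  qed
  have acc: "real (\<Sum>B\<in>final_blocks P th N m od. height B) \<le> S"
  proof -
    have "(\<Sum>B\<in>final_blocks P th N m od. height B) \<le> sum weight (final_blocks P th N m od)"
      by (intro sum_mono) (simp add: weight_def)
    then show ?thesis unfolding S_def lnN_def using sum_weight_final_le[OF N] by linarith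
  qed
  have "real N * (2 / 3) \<le> real N * lnN" using lnN by (intro mult_left_mono) auto
  then have vecs: "real (N + num_cols N m od) \<le> S" using num_cols_le[of N m od] unfolding S_def by simp
  have S0: "0 \<le> S" using lnN by (simp add: S_def)
  have "(real C3 + 2 * M + 1) * S \<le> (real C3 + 2 * A + 1) * (rho * (1 + lnN)) * S"
  proof -
    have "1 * 1 \<le> rho * (1 + lnN)" using rho lnN by (intro mult_mono) auto
    then have "(real C3 + 1) * 1 \<le> (real C3 + 1) * (rho * (1 + lnN))" by (intro mult_left_mono) auto
    then have "real C3 + 2 * M + 1 \<le> (real C3 + 2 * A + 1) * (rho * (1 + lnN))"
      unfolding M_def by (simp add: algebra_simps)
    then show ?thesis using S0 by (rule mult_right_mono)
  qed
  also have "\<dots> \<le> (real C3 + 2 * A + 1) * (rho * (5 / 2 * lnN)) * S"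
    using lnN rho A S0 by (intro mult_right_mono mult_left_mono) auto
  also have "\<dots> = C * (real r)\<^sup>2 * real N * (ln (real N))\<^sup>2"
    by (simp add: C_def S_def rho_def lnN_def A_def power2_eq_square algebra_simps)
  finally have fin: "(real C3 + 2 * M + 1) * S \<le> C * (real r)\<^sup>2 * real N * (ln (real N))\<^sup>2" .
  have expand: "(real C3 + 2 * M + 1) * S = real C3 * S + M * S + M * S + S"
    by (simp add: algebra_simps)
  show "real (time_complexity P th N m od) \<le> C * (real r)\<^sup>2 * real N * (ln (real N))\<^sup>2"
    using books build apply1 acc fin expand
    unfolding time_complexity_def precomputation_time_def application_time_def of_nat_add by linarith
  show "real (memory_complexity P th N m od) \<le> C * (real r)\<^sup>2 * real N * (ln (real N))\<^sup>2"
    using books build_mem apply_mem vecs fin expand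
    unfolding memory_complexity_def precomputation_memory_def application_memory_def of_nat_add by linarith
qed

end

text \<open>The linear dependence on the rank of three of the four costs is weakened to a quadratic one.\<close>

lemma lowrank_complexityD:
  assumes "lowrank_complexity \<epsilon> W"
  obtains C :: real where "\<And>K r t. 0 < dim_row K \<Longrightarrow> 0 < dim_col K \<Longrightarrow> 1 \<le> r \<Longrightarrow>
    numerical_rank \<epsilon> K \<le> r \<Longrightarrow>
    t \<in> {build_time W c K, build_mem W K, apply_time W K, apply_mem W K} \<Longrightarrow>
    real t \<le> C * (real r)\<^sup>2 * real (mat_size K)"
proof -
  obtain C where C: "\<And>K r. 0 < dim_row K \<Longrightarrow> 0 < dim_col K \<Longrightarrow> 1 \<le> r \<Longrightarrow> numerical_rank \<epsilon> K \<le> r \<Longrightarrow>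
      real (build_time W c K) \<le> C * (real r)\<^sup>2 * real (mat_size K) \<and>
      (\<forall>t\<in>{build_mem W K, apply_time W K, apply_mem W K}. real t \<le> C * real r * real (mat_size K))"
    using assms unfolding lowrank_complexity_def by metis
  have "real t \<le> \<bar>C\<bar> * (real r)\<^sup>2 * real (mat_size K)"
    if K: "0 < dim_row K" "0 < dim_col K" and r: "1 \<le> r" "numerical_rank \<epsilon> K \<le> r"
      and t: "t \<in> {build_time W c K, build_mem W K, apply_time W K, apply_mem W K}" for K r t
  proof -
    have 1: "C * (real r)\<^sup>2 * real (mat_size K) \<le> \<bar>C\<bar> * (real r)\<^sup>2 * real (mat_size K)"
      by (intro mult_right_mono) auto
    have "real r * 1 \<le> real r * real r" using r by (intro mult_left_mono) auto
    then have 2: "C * real r * real (mat_size K) \<le> \<bar>C\<bar> * (real r)\<^sup>2 * real (mat_size K)"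
      by (intro mult_right_mono mult_mono) (auto simp: power2_eq_square)
    have "real t \<le> C * (real r)\<^sup>2 * real (mat_size K) \<or> real t \<le> C * real r * real (mat_size K)"
      using C[OF K r] t by auto
    then show ?thesis using 1 2 by linarith
  qed
  then show ?thesis by (rule that)
qed

theorem theorem4p1:
  fixes \<epsilon> \<mu> :: real and P :: algorithm and \<theta> :: "nat \<Rightarrow> nat \<Rightarrow> real"
  assumes "0 < \<epsilon>" and "0 < \<mu>"
    and "valid_algorithm \<epsilon> \<mu> P"
    and "\<And>N. 1 \<le> N \<Longrightarrow> gauss_legendre_angles N (\<theta> N)"
  shows "(\<exists>C :: real. \<exists>N\<^sub>1. \<forall>N\<ge>N\<^sub>1. \<forall>m od. admissible N m od \<longrightarrow>
            real (time_complexity P (\<theta> N) N m od)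
              \<le> C * (real (rank_bound \<epsilon> P (\<theta> N) N))\<^sup>2 * real N * (ln (real N))\<^sup>2 \<and>
            real (memory_complexity P (\<theta> N) N m od)
              \<le> C * (real (rank_bound \<epsilon> P (\<theta> N) N))\<^sup>2 * real N * (ln (real N))\<^sup>2) \<and>
         (\<exists>C :: real. \<forall>N\<ge>2. \<forall>m od. admissible N m od \<longrightarrow>
            real (time_complexity P (\<theta> N) N m od)
              \<le> C * (real (max 1 (matrix_rank_bound \<epsilon> P (\<theta> N) N m od)))\<^sup>2 * real N * (ln (real N))\<^sup>2 \<and>
            real (memory_complexity P (\<theta> N) N m od)
              \<le> C * (real (max 1 (matrix_rank_bound \<epsilon> P (\<theta> N) N m od)))\<^sup>2 * real N * (ln (real N))\<^sup>2)"
proof -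
  note valid = assms(3)[unfolded valid_algorithm_def]
  obtain C1 :: real where C1: "\<And>K r t. 0 < dim_row K \<Longrightarrow> 0 < dim_col K \<Longrightarrow>
      dim_row K \<le> 5 * dim_col K \<Longrightarrow> dim_col K \<le> 5 * dim_row K \<Longrightarrow> 1 \<le> r \<Longrightarrow>
      (\<And>S. S \<in> relevant_subblocks (depth P) K \<Longrightarrow> numerical_rank \<epsilon> S \<le> r) \<Longrightarrow>
      t \<in> {build_time (idbf P) (entry_cost P) K, build_mem (idbf P) K,
        apply_time (idbf P) K, apply_mem (idbf P) K} \<Longrightarrow>
      real t \<le> C1 * (real r)\<^sup>2 * real (mat_size K) * (1 + ln (real (mat_size K)))"
  proof -
    have "idbf_complexity \<epsilon> (depth P) (idbf P)" using valid by blast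
    from this[unfolded idbf_complexity_def, rule_format, of 5 "entry_cost P"]
    show ?thesis using that by meson
  qed
  obtain C2 :: real where C2: "\<And>K r t. 0 < dim_row K \<Longrightarrow> 0 < dim_col K \<Longrightarrow> 1 \<le> r \<Longrightarrow>
      numerical_rank \<epsilon> K \<le> r \<Longrightarrow>
      t \<in> {build_time (lowrank P) (entry_cost P) K, build_mem (lowrank P) K,
        apply_time (lowrank P) K, apply_mem (lowrank P) K} \<Longrightarrow>
      real t \<le> C2 * (real r)\<^sup>2 * real (mat_size K)"
    using lowrank_complexityD[of \<epsilon> "lowrank P" "entry_cost P"] valid by metis
  obtain C3 where C3: "\<And>N m od B. bookkeeping P N m od B \<le> C3 * (height B + width B)"
    using valid by blast
  have trim: "subblock_of K (trim P K)" for K using valid by (simp add: largest_nontiny_def)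
  define C where "C = 150 * (real C3 + 2 * (\<bar>C1\<bar> + \<bar>C2\<bar> + real ((entry_cost P + 2) * min_size P)) + 1)"
  have C0: "0 \<le> C" by (simp add: C_def)
  have main: "real (time_complexity P (\<theta> N) N m od)
        \<le> C * (real (max 1 (matrix_rank_bound \<epsilon> P (\<theta> N) N m od)))\<^sup>2 * real N * (ln (real N))\<^sup>2 \<and>
      real (memory_complexity P (\<theta> N) N m od)
        \<le> C * (real (max 1 (matrix_rank_bound \<epsilon> P (\<theta> N) N m od)))\<^sup>2 * real N * (ln (real N))\<^sup>2"
    if N: "2 \<le> N" and adm: "admissible N m od" for N m od
  proof -
    interpret alt_partition N m od "\<theta> N" P
      using adm assms(4)[of N] N valid by unfold_locales auto
    show ?thesis unfolding C_def
      using complexity_le[OF N assms(1) C1 C2 C3 trim] by blast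
  qed
  have "real (time_complexity P (\<theta> N) N m od)
        \<le> C * (real (rank_bound \<epsilon> P (\<theta> N) N))\<^sup>2 * real N * (ln (real N))\<^sup>2 \<and>
      real (memory_complexity P (\<theta> N) N m od)
        \<le> C * (real (rank_bound \<epsilon> P (\<theta> N) N))\<^sup>2 * real N * (ln (real N))\<^sup>2"
    if N: "max 2 (nat \<lceil>2 * \<epsilon>\<^sup>2\<rceil> + 1) \<le> N" and adm: "admissible N m od" for N m od
  proof -
    have "2 * \<epsilon>\<^sup>2 < real N" using N by linarith
    then have "1 \<le> rank_bound \<epsilon> P (\<theta> N) N" by (rule rank_bound_pos[OF assms(1)])
    moreover have "matrix_rank_bound \<epsilon> P (\<theta> N) N m od \<le> rank_bound \<epsilon> P (\<theta> N) N"
      using assms(1) adm by (intro matrix_rank_bound_le_rank_bound) auto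
    ultimately have "C * (real (max 1 (matrix_rank_bound \<epsilon> P (\<theta> N) N m od)))\<^sup>2 * real N * (ln (real N))\<^sup>2
        \<le> C * (real (rank_bound \<epsilon> P (\<theta> N) N))\<^sup>2 * real N * (ln (real N))\<^sup>2"
      using C0 by (intro mult_right_mono mult_left_mono power_mono) auto
    then show ?thesis using main[of N m od] N adm by fastforce
  qed
  then show ?thesis using main by blast
qed

end
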